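(* Let $\mathfrak{g}$ be a simple Lie algebra of dimension $8$ over $\mathbb{Q}$ such that $\mathfrak{g}\otimes\mathbb{C}\cong\mathfrak{sl}_3(\mathbb{C})$, let $\rho:\mathfrak{g}\to\mathfrak{gl}(V)$ be the rational representation of $\mathfrak{g}$ constructed in the context from a (non-split) Cartan subalgebra, and set $A=\rho(\mathfrak{g})^*$, the associative $\mathbb{Q}$-algebra generated by $\rho(\mathfrak{g})$. Suppose that $\dim_{\mathbb{Q}}(A)=9$. Then $A$ is a central simple algebra (over $\mathbb{Q}$). Furthermore, $\mathfrak{g}$ is isomorphic to $\mathfrak{sl}_3(\mathbb{Q})$ if and only if $A$ is isomorphic to $M_3(\mathbb{Q})$, the algebra of $3\times3$-matrices over $\mathbb{Q}$.
   Context: Construction of $\rho$: Let $H$ be a Cartan subalgebra of $\mathfrak{g}$, assumed not split (a Cartan subalgebra is split if $\mathrm{ad}\,h$ has all its eigenvalues in $\mathbb{Q}$ for all $h\in H$). Let $F$ be a number field containing the eigenvalues of $\mathrm{ad}\,h$ for all $h\in H$. Then $H\otimes F$ is a split Cartan subalgebra of $\mathfrak{g}\otimes F$, so there is an isomorphism $\mathfrak{g}\otimes F\to\mathfrak{sl}_3(F)$; fix one. It gives a representation $\rho':\mathfrak{g}\otimes F\to\mathfrak{gl}(V')$ on a $3$-dimensional $F$-vector space $V'$. Let $W$ be the $\mathbb{Q}$-span of a basis of $V'$ and let $V=F\otimes_{\mathbb{Q}}W$, viewed as a vector space over $\mathbb{Q}$. Let $\phi:V\to V'$ be the bijective $\mathbb{Q}$-linear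 map with $\phi(\alpha\otimes w)=\alpha w$. Define $\rho:\mathfrak{g}\to\mathfrak{gl}(V)$ by $\rho(x)=\phi^{-1}\circ\rho'(x)\circ\phi$. *)

theory Defs
  imports "HOL-Analysis.Analysis" "HOL-Library.Function_Algebras" "HOL-Library.Poly_Mapping"
begin

section \<open>Vector spaces and Lie algebras over the rationals\<close>

class rat_vector = ab_group_add +
  fixes scaleQ :: "rat \<Rightarrow> 'a \<Rightarrow> 'a"
  assumes scaleQ_add_right: "scaleQ q (x + y) = scaleQ q x + scaleQ q y"
    and scaleQ_add_left: "scaleQ (q + r) x = scaleQ q x + scaleQ r x"
    and scaleQ_scaleQ: "scaleQ q (scaleQ r x) = scaleQ (q * r) x"
    and scaleQ_one: "scaleQ 1 x = x"

global_interpretation rat_vector: vector_space "scaleQ :: rat \<Rightarrow> 'a \<Rightarrow> 'a::rat_vector"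
  by unfold_locales (simp_all add: scaleQ_add_right scaleQ_add_left scaleQ_scaleQ scaleQ_one)

instantiation "fun" :: (type, rat_vector) rat_vector
begin

definition "scaleQ q f = (\<lambda>x. scaleQ q (f x))"

instance
  by standard
    (simp_all add: scaleQ_fun_def fun_eq_iff scaleQ_add_right scaleQ_add_left scaleQ_scaleQ
      scaleQ_one)

end

class rat_lie_algebra = rat_vector +
  fixes bracket :: "'a \<Rightarrow> 'a \<Rightarrow> 'a"
  assumes bracket_add_left: "bracket (x + y) z = bracket x z + bracket y z"
    and bracket_add_right: "bracket x (y + z) = bracket x y + bracket x z"
    and bracket_scaleQ_left: "bracket (scaleQ q x) y = scaleQ q (bracket x y)"
    and bracket_scaleQ_right: "bracket x (scaleQ q y) = scaleQ q (bracket x y)"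
    and bracket_self: "bracket x x = 0"
    and jacobi: "bracket x (bracket y z) + bracket y (bracket z x) + bracket z (bracket x y) = 0"

definition lie_ideal :: "'g::rat_lie_algebra set \<Rightarrow> bool" where
  "lie_ideal I \<longleftrightarrow> rat_vector.subspace I \<and> (\<forall>x. \<forall>y\<in>I. bracket x y \<in> I)"

definition simple_lie_algebra :: "'g::rat_lie_algebra itself \<Rightarrow> bool" where
  "simple_lie_algebra T \<longleftrightarrow> (\<exists>x y :: 'g. bracket x y \<noteq> 0) \<and>
     (\<forall>I :: 'g set. lie_ideal I \<longrightarrow> I = {0} \<or> I = UNIV)"

definition lie_subalgebra :: "'g::rat_lie_algebra set \<Rightarrow> bool" where
  "lie_subalgebra H \<longleftrightarrow> rat_vector.subspace H \<and> (\<forall>x\<in>H. \<forall>y\<in>H. bracket x y \<in> H)"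

fun lower_central :: "'g::rat_lie_algebra set \<Rightarrow> nat \<Rightarrow> 'g set" where
  "lower_central H 0 = H"
| "lower_central H (Suc n) =
     rat_vector.span {bracket x y | x y. x \<in> H \<and> y \<in> lower_central H n}"

definition nilpotent_lie :: "'g::rat_lie_algebra set \<Rightarrow> bool" where
  "nilpotent_lie H \<longleftrightarrow> (\<exists>n. lower_central H n = {0})"

definition normalizer :: "'g::rat_lie_algebra set \<Rightarrow> 'g set" where
  "normalizer H = {x. \<forall>h\<in>H. bracket x h \<in> H}"

definition cartan_subalgebra :: "'g::rat_lie_algebra set \<Rightarrow> bool" where
  "cartan_subalgebra H \<longleftrightarrow> lie_subalgebra H \<and> nilpotent_lie H \<and> normalizer H = H"


section \<open>Extension of scalars\<close>

text \<open>
  The tensor product \<open>K \<otimes> V\<close> over \<open>\<rat>\<close>, for a field \<open>K\<close> of characteristic 0 (a \<open>\<rat>\<close>-vector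
  space via \<^const>\<open>of_rat\<close>) and a \<open>\<rat>\<close>-vector space \<open>V\<close>: the free abelian group on \<open>K \<times> V\<close>
  modulo the subgroup generated by the biadditivity relations and the relations
  \<open>(a q, v) = (a, q v)\<close>.
\<close>

inductive_set tensor_null :: "('k::field_char_0 \<times> 'v::rat_vector \<Rightarrow>\<^sub>0 int) set" where
  zero: "0 \<in> tensor_null"
| diff: "s \<in> tensor_null \<Longrightarrow> t \<in> tensor_null \<Longrightarrow> s - t \<in> tensor_null"
| left: "frag_of (a + b, v) - (frag_of (a, v) + frag_of (b, v)) \<in> tensor_null"
| right: "frag_of (a, v + w) - (frag_of (a, v) + frag_of (a, w)) \<in> tensor_null"
| balanced: "frag_of (a * of_rat q, v) - frag_of (a, scaleQ q v) \<in> tensor_null"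

lemma tensor_null_uminus: "s \<in> tensor_null \<Longrightarrow> - s \<in> tensor_null"
  using tensor_null.diff[OF tensor_null.zero] by force

lemma tensor_null_add: "s \<in> tensor_null \<Longrightarrow> t \<in> tensor_null \<Longrightarrow> s + t \<in> tensor_null"
  using tensor_null.diff[OF _ tensor_null_uminus] by force

quotient_type (overloaded) ('k, 'v) tensor =
  "('k::field_char_0 \<times> 'v::rat_vector) \<Rightarrow>\<^sub>0 int" / "\<lambda>s t. s - t \<in> tensor_null"
proof (rule equivpI)
  show "reflp (\<lambda>s t :: ('k \<times> 'v) \<Rightarrow>\<^sub>0 int. s - t \<in> tensor_null)"
    by (simp add: reflp_def tensor_null.zero)
  show "symp (\<lambda>s t :: ('k \<times> 'v) \<Rightarrow>\<^sub>0 int. s - t \<in> tensor_null)"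
    by (rule sympI, drule tensor_null_uminus) simp
  show "transp (\<lambda>s t :: ('k \<times> 'v) \<Rightarrow>\<^sub>0 int. s - t \<in> tensor_null)"
    by (rule transpI, drule (1) tensor_null_add) simp
qed

instantiation tensor :: (field_char_0, rat_vector) ab_group_add
begin

lift_definition zero_tensor :: "('a, 'b) tensor" is 0 .

lift_definition plus_tensor :: "('a, 'b) tensor \<Rightarrow> ('a, 'b) tensor \<Rightarrow> ('a, 'b) tensor" is "(+)"
  by (drule (1) tensor_null_add) (simp add: algebra_simps)

lift_definition uminus_tensor :: "('a, 'b) tensor \<Rightarrow> ('a, 'b) tensor" is uminus
  by (drule tensor_null_uminus) (simp add: algebra_simps)

lift_definition minus_tensor :: "('a, 'b) tensor \<Rightarrow> ('a, 'b) tensor \<Rightarrow> ('a, 'b) tensor" is "(-)"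
  by (drule (1) tensor_null.diff) (simp add: algebra_simps)

instance
  by standard (transfer; simp add: algebra_simps tensor_null.zero)+

end

lift_definition pure_tensor :: "'k::field_char_0 \<Rightarrow> 'v::rat_vector \<Rightarrow> ('k, 'v) tensor" is
  "\<lambda>a v. frag_of (a, v)" .

lemma pure_tensor_add_left: "pure_tensor (a + b) v = pure_tensor a v + pure_tensor b v"
  by transfer (rule tensor_null.left)

lemma pure_tensor_add_right: "pure_tensor a (v + w) = pure_tensor a v + pure_tensor a w"
  by transfer (rule tensor_null.right)

lemma pure_tensor_balanced: "pure_tensor (a * of_rat q) v = pure_tensor a (scaleQ q v)"
  by transfer (rule tensor_null.balanced)

lemma frag_induct [case_names zero gen diff]:
  assumes "P 0" and "\<And>p. P (frag_of p)" and "\<And>s t. P s \<Longrightarrow> P t \<Longrightarrow> P (s - t)"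
  shows "P s"
  by (rule frag_induction[where S = UNIV]) (use assms in auto)

lemma tensor_induct [case_names zero pure diff]:
  assumes "P 0" and "\<And>a v. P (pure_tensor a v)" and "\<And>x y. P x \<Longrightarrow> P y \<Longrightarrow> P (x - y)"
  shows "P x"
proof -
  have "P (abs_tensor s)" for s
  proof (induction s rule: frag_induct)
    case (gen p)
    then show ?case
      using assms(2) by (cases p) (simp add: pure_tensor.abs_eq)
  qed (use assms in \<open>simp_all add: zero_tensor.abs_eq minus_tensor.abs_eq[symmetric]\<close>)
  then show ?thesis
    by (induction x rule: tensor.abs_induct)
qed

lift_definition scaleK :: "'k::field_char_0 \<Rightarrow> ('k, 'v::rat_vector) tensor \<Rightarrow> ('k, 'v) tensor" is
  "\<lambda>c. frag_extend (\<lambda>(a, v). frag_of (c * a, v))"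
proof -
  fix c :: 'k and s t :: "('k \<times> 'v) \<Rightarrow>\<^sub>0 int"
  have "frag_extend (\<lambda>(a, v). frag_of (c * a, v)) u \<in> tensor_null" if "u \<in> tensor_null"
    for u :: "('k \<times> 'v) \<Rightarrow>\<^sub>0 int"
    using that
    by induction
      (auto simp: frag_extend_diff frag_extend_add distrib_left mult.assoc[symmetric]
        intro: tensor_null.intros)
  then show "s - t \<in> tensor_null \<Longrightarrow>
      frag_extend (\<lambda>(a, v). frag_of (c * a, v)) s - frag_extend (\<lambda>(a, v). frag_of (c * a, v)) t
        \<in> tensor_null"
    by (simp add: frag_extend_diff[symmetric])
qed

lemma scaleK_pure: "scaleK c (pure_tensor a v) = pure_tensor (c * a) v"
  by transfer (simp add: tensor_null.zero)

lemma scaleK_diff: "scaleK c (x - y) = scaleK c x - scaleK c y"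
  by transfer (simp add: frag_extend_diff tensor_null.zero)

lemma scaleK_add: "scaleK c (x + y) = scaleK c x + scaleK c y"
  by transfer (simp add: frag_extend_add tensor_null.zero)

lemma scaleK_zero: "scaleK c 0 = 0"
  by transfer (simp add: tensor_null.zero)

global_interpretation tensor: vector_space "scaleK :: 'k \<Rightarrow> ('k::field_char_0, 'v::rat_vector) tensor \<Rightarrow> _"
proof
  fix a b :: 'k and x y :: "('k, 'v) tensor"
  show "scaleK a (x + y) = scaleK a x + scaleK a y"
    by (rule scaleK_add)
  show "scaleK (a + b) x = scaleK a x + scaleK b x"
    by (induction x rule: tensor_induct)
      (simp_all add: scaleK_zero scaleK_diff scaleK_pure distrib_right pure_tensor_add_left)
  show "scaleK a (scaleK b x) = scaleK (a * b) x"
    by (induction x rule: tensor_induct)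
      (simp_all add: scaleK_zero scaleK_diff scaleK_pure mult.assoc)
  show "scaleK 1 x = x"
    by (induction x rule: tensor_induct)
      (simp_all add: scaleK_zero scaleK_diff scaleK_pure)
qed

instantiation tensor :: (field_char_0, rat_vector) rat_vector
begin

definition "scaleQ q x = scaleK (of_rat q) x"

instance
  by standard
    (simp_all add: scaleQ_tensor_def of_rat_add of_rat_mult tensor.scale_right_distrib
      tensor.scale_left_distrib)

end

definition frag_bracket :: "(('k::field_char_0 \<times> 'g::rat_lie_algebra) \<Rightarrow>\<^sub>0 int) \<Rightarrow>
    (('k \<times> 'g) \<Rightarrow>\<^sub>0 int) \<Rightarrow> (('k \<times> 'g) \<Rightarrow>\<^sub>0 int)" where
  "frag_bracket s t =
     frag_extend (\<lambda>(a, x). frag_extend (\<lambda>(b, y). frag_of (a * b, bracket x y)) t) s"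

lemma frag_bracket_zero_left: "frag_bracket 0 t = 0"
  by (simp add: frag_bracket_def)

lemma frag_bracket_diff_left: "frag_bracket (s - s') t = frag_bracket s t - frag_bracket s' t"
  by (simp add: frag_bracket_def frag_extend_diff)

lemma frag_bracket_zero_right: "frag_bracket s 0 = 0"
  by (simp add: frag_bracket_def frag_extend_eq_0 split: prod.splits)

lemma frag_bracket_diff_right: "frag_bracket s (t - t') = frag_bracket s t - frag_bracket s t'"
proof (induction s rule: frag_induct)
  case (gen p)
  then show ?case
    by (cases p) (simp add: frag_bracket_def frag_extend_diff)
qed (simp_all add: frag_bracket_zero_left frag_bracket_diff_left)

lemma frag_bracket_add_left: "frag_bracket (s + s') t = frag_bracket s t + frag_bracket s' t"
  by (simp add: frag_bracket_def frag_extend_add)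

lemma frag_bracket_add_right: "frag_bracket s (t + t') = frag_bracket s t + frag_bracket s t'"
  by (metis diff_add_cancel eq_diff_eq frag_bracket_diff_right)

lemma frag_bracket_of: "frag_bracket (frag_of (a, x)) (frag_of (b, y)) = frag_of (a * b, bracket x y)"
  by (simp add: frag_bracket_def)

lemma frag_bracket_null_left: "s \<in> tensor_null \<Longrightarrow> frag_bracket s t \<in> tensor_null"
proof (induction t rule: frag_induct)
  case (gen p)
  obtain b y where p: "p = (b, y)" by (cases p)
  have balanced': "frag_of (a * of_rat q * b, v) - frag_of (a * b, scaleQ q v) \<in> tensor_null"
    for a q and v :: 'b
    using tensor_null.balanced[of "a * b" q v] by (simp add: mult.assoc mult.commute[of b])
  from gen show ?case
    unfolding p
    by induction
      (auto simp: frag_bracket_zero_left frag_bracket_diff_left frag_bracket_add_left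
        frag_bracket_of distrib_right bracket_add_left bracket_scaleQ_left
        intro: tensor_null.intros balanced')
qed (auto simp: frag_bracket_zero_right frag_bracket_diff_right intro: tensor_null.intros)

lemma frag_bracket_null_right: "t \<in> tensor_null \<Longrightarrow> frag_bracket s t \<in> tensor_null"
proof (induction s rule: frag_induct)
  case (gen p)
  obtain b y where p: "p = (b, y)" by (cases p)
  from gen show ?case
    unfolding p
    by induction
      (auto simp: frag_bracket_zero_right frag_bracket_diff_right frag_bracket_add_right
        frag_bracket_of distrib_left bracket_add_right bracket_scaleQ_right mult.assoc[symmetric]
        intro: tensor_null.intros)
qed (auto simp: frag_bracket_zero_left frag_bracket_diff_left intro: tensor_null.intros)

lift_definition bracketK :: "('k::field_char_0, 'g::rat_lie_algebra) tensor \<Rightarrow> ('k, 'g) tensor \<Rightarrow>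
    ('k, 'g) tensor" is frag_bracket
proof -
  fix s s' t t' :: "('k \<times> 'g) \<Rightarrow>\<^sub>0 int"
  assume "s - s' \<in> tensor_null" "t - t' \<in> tensor_null"
  then have "frag_bracket (s - s') t + frag_bracket s' (t - t') \<in> tensor_null"
    by (intro tensor_null_add frag_bracket_null_left frag_bracket_null_right)
  then show "frag_bracket s t - frag_bracket s' t' \<in> tensor_null"
    by (simp add: frag_bracket_diff_left frag_bracket_diff_right)
qed

lemma bracketK_pure:
  "bracketK (pure_tensor a x) (pure_tensor b y) = pure_tensor (a * b) (bracket x y)"
  by transfer (simp add: frag_bracket_of tensor_null.zero)


section \<open>Eigenvalues and number fields\<close>

text \<open>The eigenvalues of \<open>ad h\<close> are those of its extension to \<open>\<complex> \<otimes> \<gg>\<close>.\<close>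

definition ad_eigenvalues :: "'g::rat_lie_algebra \<Rightarrow> complex set" where
  "ad_eigenvalues h =
     {c. \<exists>v :: (complex, 'g) tensor. v \<noteq> 0 \<and> bracketK (pure_tensor 1 h) v = scaleK c v}"

definition split_cartan :: "'g::rat_lie_algebra set \<Rightarrow> bool" where
  "split_cartan H \<longleftrightarrow> cartan_subalgebra H \<and> (\<forall>h\<in>H. ad_eigenvalues h \<subseteq> \<rat>)"

lemma vector_space_of_rat: "vector_space (\<lambda>q x. of_rat q * x :: 'f::field_char_0)"
  by unfold_locales (simp_all add: algebra_simps of_rat_add of_rat_mult)

definition number_field :: "'f::field_char_0 itself \<Rightarrow> bool" where
  "number_field T \<longleftrightarrow>
     (\<exists>S :: 'f set. finite S \<and> module.span (\<lambda>q x. of_rat q * x) S = UNIV)"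

definition field_embedding :: "('f::field \<Rightarrow> 'e::field) \<Rightarrow> bool" where
  "field_embedding e \<longleftrightarrow>
     e 1 = 1 \<and> (\<forall>x y. e (x + y) = e x + e y) \<and> (\<forall>x y. e (x * y) = e x * e y)"


section \<open>The Lie algebra of trace-zero matrices\<close>

definition mscale :: "'k::field \<Rightarrow> 'k^'n^'n \<Rightarrow> 'k^'n^'n" where
  "mscale c M = (\<chi> i j. c * M $ i $ j)"

definition sl :: "('k::field^'n^'n) set" where
  "sl = {M. trace M = 0}"

definition commutator :: "'k::field^'n^'n \<Rightarrow> 'k^'n^'n \<Rightarrow> 'k^'n^'n" where
  "commutator M N = M ** N - N ** M"

definition lie_iso_sl ::
  "('k::field \<Rightarrow> 'a::ab_group_add \<Rightarrow> 'a) \<Rightarrow> ('a \<Rightarrow> 'a \<Rightarrow> 'a) \<Rightarrow> ('a \<Rightarrow> 'k^'n^'n) \<Rightarrow> bool" where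
  "lie_iso_sl sc br f \<longleftrightarrow> Vector_Spaces.linear sc mscale f \<and>
     (\<forall>x y. f (br x y) = commutator (f x) (f y)) \<and> bij_betw f UNIV sl"

lemma vector_space_mscale: "vector_space (mscale :: 'k::field \<Rightarrow> 'k^'n^'n \<Rightarrow> _)"
  by unfold_locales (simp_all add: mscale_def vec_eq_iff algebra_simps)


section \<open>Associative algebras\<close>

locale assoc_algebra = vector_space scale
  for scale :: "'k::field \<Rightarrow> 'a::ab_group_add \<Rightarrow> 'a" +
  fixes mult :: "'a \<Rightarrow> 'a \<Rightarrow> 'a" and one :: 'a and A :: "'a set"
  assumes carrier_subspace: "subspace A"
    and one_closed: "one \<in> A"
    and mult_closed: "x \<in> A \<Longrightarrow> y \<in> A \<Longrightarrow> mult x y \<in> A"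
    and mult_assoc: "x \<in> A \<Longrightarrow> y \<in> A \<Longrightarrow> z \<in> A \<Longrightarrow> mult (mult x y) z = mult x (mult y z)"
    and one_left: "x \<in> A \<Longrightarrow> mult one x = x"
    and one_right: "x \<in> A \<Longrightarrow> mult x one = x"
    and mult_add_left: "x \<in> A \<Longrightarrow> y \<in> A \<Longrightarrow> z \<in> A \<Longrightarrow> mult (x + y) z = mult x z + mult y z"
    and mult_add_right: "x \<in> A \<Longrightarrow> y \<in> A \<Longrightarrow> z \<in> A \<Longrightarrow> mult x (y + z) = mult x y + mult x z"
    and mult_scale_left: "x \<in> A \<Longrightarrow> y \<in> A \<Longrightarrow> mult (scale c x) y = scale c (mult x y)"
    and mult_scale_right: "x \<in> A \<Longrightarrow> y \<in> A \<Longrightarrow> mult x (scale c y) = scale c (mult x y)"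
begin

definition two_sided_ideal :: "'a set \<Rightarrow> bool" where
  "two_sided_ideal I \<longleftrightarrow> I \<subseteq> A \<and> subspace I \<and>
     (\<forall>a\<in>A. \<forall>x\<in>I. mult a x \<in> I \<and> mult x a \<in> I)"

definition center :: "'a set" where
  "center = {z \<in> A. \<forall>a\<in>A. mult z a = mult a z}"

end

locale central_simple_algebra = assoc_algebra +
  assumes finite_dim: "\<exists>S. finite S \<and> span S = A"
    and one_nonzero: "one \<noteq> 0"
    and central: "center = range (\<lambda>c. scale c one)"
    and simple: "two_sided_ideal I \<Longrightarrow> I = {0} \<or> I = A"

definition algebra_iso_matrix ::
  "('k::field \<Rightarrow> 'a::ab_group_add \<Rightarrow> 'a) \<Rightarrow> ('a \<Rightarrow> 'a \<Rightarrow> 'a) \<Rightarrow> 'a \<Rightarrow> 'a set \<Rightarrow>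
    ('a \<Rightarrow> 'k^'n^'n) \<Rightarrow> bool" where
  "algebra_iso_matrix sc mul e A f \<longleftrightarrow> bij_betw f A UNIV \<and> f e = mat 1 \<and>
     (\<forall>x\<in>A. \<forall>y\<in>A. f (x + y) = f x + f y \<and> f (mul x y) = f x ** f y) \<and>
     (\<forall>c. \<forall>x\<in>A. f (sc c x) = mscale c (f x))"

text \<open>
  The (unital) associative \<open>\<rat>\<close>-algebra of endomorphisms generated by a set \<open>S\<close>; the product is
  composition, the vector space operations are pointwise.
\<close>

inductive_set generated_algebra :: "('v::rat_vector \<Rightarrow> 'v) set \<Rightarrow> ('v \<Rightarrow> 'v) set"
  for S :: "('v \<Rightarrow> 'v) set" where
  generator: "f \<in> S \<Longrightarrow> f \<in> generated_algebra S"
| one: "id \<in> generated_algebra S"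
| add: "f \<in> generated_algebra S \<Longrightarrow> g \<in> generated_algebra S \<Longrightarrow> f + g \<in> generated_algebra S"
| scale: "f \<in> generated_algebra S \<Longrightarrow> scaleQ q f \<in> generated_algebra S"
| mult: "f \<in> generated_algebra S \<Longrightarrow> g \<in> generated_algebra S \<Longrightarrow> f \<circ> g \<in> generated_algebra S"


section \<open>The rational representation\<close>

definition scaleQ_vec :: "rat \<Rightarrow> 'f::field_char_0^'n \<Rightarrow> 'f^'n" where
  "scaleQ_vec q v = of_rat q *s v"

lemma vector_space_scaleQ_vec: "vector_space (scaleQ_vec :: rat \<Rightarrow> 'f::field_char_0^'n \<Rightarrow> _)"
  by unfold_locales
    (simp_all add: scaleQ_vec_def vec_eq_iff algebra_simps of_rat_add of_rat_mult)

text \<open>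
  For \<open>\<Phi> : F \<otimes> \<gg> \<rightarrow> sl\<^sub>n(F)\<close>, the representation of \<open>F \<otimes> \<gg>\<close> on \<open>V' = F\<^sup>n\<close> is
  \<open>\<rho>'(X) v = \<Phi>(X) v\<close>; \<open>\<gg>\<close> is embedded in \<open>F \<otimes> \<gg>\<close> by \<open>x \<mapsto> 1 \<otimes> x\<close>.
\<close>

definition rational_rep ::
  "(('f::field_char_0, 'g::rat_lie_algebra) tensor \<Rightarrow> 'f^'n^'n) \<Rightarrow> ('v \<Rightarrow> 'f^'n) \<Rightarrow> 'g \<Rightarrow> 'v \<Rightarrow> 'v" where
  "rational_rep \<Phi> \<phi> x = inv \<phi> \<circ> (\<lambda>v. \<Phi> (pure_tensor 1 x) *v v) \<circ> \<phi>"

end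

theory Submission
  imports Defs
begin

text \<open>
  Write \<open>\<theta> x\<close> for the matrix \<open>\<Phi> (1 \<otimes> x)\<close>. Conjugation by \<open>\<phi>\<close> identifies \<open>A\<close> with a
  \<open>\<rat>\<close>-subalgebra \<open>S\<close> of \<open>M\<^sub>3(F)\<close> generated by the trace-zero matrices \<open>\<theta> x\<close>. The map
  \<open>\<theta>\<close> is injective because its kernel is an ideal of the simple algebra \<open>\<gg>\<close>, and the identity is not
  in its range because its trace is \<open>3\<close>; as \<open>A\<close> has dimension \<open>9 = 1 + 8\<close>, it follows that
  \<open>A = \<rat> \<oplus> \<rho>(\<gg>)\<close> and that a \<open>\<rat>\<close>-basis of \<open>S\<close> is an \<open>F\<close>-basis of \<open>M\<^sub>3(F)\<close>.

  Everything about central simplicity follows from this decomposition, in which the commutator with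
  \<open>q + \<rho> x\<close> is the bracket with \<open>x\<close>. Central elements of \<open>A\<close> have their \<open>\<gg>\<close>-part in the centre of
  \<open>\<gg>\<close>, which is zero. For a two-sided ideal \<open>I\<close> the set of all \<open>x\<close> with \<open>\<rho> x \<in> I\<close> is a Lie
  ideal. If it is zero, then \<open>I\<close> consists of scalars; if it is \<open>\<gg>\<close>, then \<open>I\<close> contains a product
  \<open>\<rho> x \<rho> y\<close> with nonzero trace, hence a nonzero scalar (lemmas \<open>center_scalar\<close> and
  \<open>ideal_trivial\<close>).

  An isomorphism of \<open>A\<close> with \<open>M\<^sub>3(\<rat>)\<close> carries \<open>\<rho>(\<gg>)\<close> onto the trace-zero matrices, since
  \<open>\<gg>\<close> is perfect and traces of commutators vanish (\<open>lie_iso_of_matrix_iso\<close>). Conversely, let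
  \<open>\<gg>\<close> be isomorphic to \<open>sl\<^sub>3(\<rat>)\<close>, and let \<open>e\<close>, \<open>h\<close> correspond to \<open>E\<^sub>1\<^sub>2\<close> and
  \<open>diag(1, -1, 0)\<close>. Then \<open>\<rho>(e)\<^sup>2\<close> lies in \<open>A = \<rat> \<oplus> \<rho>(\<gg>)\<close> and has weight \<open>4\<close> under \<open>h\<close>;
  no such weight occurs, so \<open>\<rho>(e)\<^sup>2 = 0\<close> (\<open>square_zero_of_lie_iso\<close>). A nonzero \<open>3 \<times> 3\<close> matrix
  with zero square has rank one (\<open>square_zero_rank_one\<close>), so \<open>S\<close> contains a matrix \<open>u w\<^sup>T\<close>. The
  space of all \<open>x\<close> with \<open>x w\<^sup>T \<in> S\<close> is stable under \<open>S\<close>, and it is a rational form of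
  \<open>F\<^sup>3\<close>; in a basis of it the elements of \<open>S\<close> have rational entries, and a dimension count shows that
  all rational matrices occur (\<open>rational_form_conjugate\<close>).
\<close>

section \<open>Linear algebra over a field and over the rationals\<close>

lemma (in vector_space) independent_if_spans_independent:
  assumes E: "independent E" "E \<subseteq> span T" and T: "finite T" "card T \<le> card E"
  shows "independent T"
proof
  assume "dependent T"
  then obtain t where t: "t \<in> T" "t \<in> span (T - {t})"
    unfolding dependent_def by blast
  then have "span (T - {t}) = span T"
    using span_redundant[OF t(2)] by (simp add: insert_absorb)
  with E T have "card E \<le> card (T - {t})"
    using independent_span_bound[of "T - {t}" E] by auto
  with t T show False
    by (metis card_Diff1_less leD order_trans)
qed

lemma (in vector_space) spans_if_independent_card:
  assumes E: "finite E" "V \<subseteq> span E" and T: "T \<subseteq> V" "independent T" "card E \<le> card T"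
  shows "V \<subseteq> span T"
proof
  fix x assume x: "x \<in> V"
  show "x \<in> span T"
  proof (rule ccontr)
    assume nin: "x \<notin> span T"
    then have "independent (insert x T)"
      using T(2) by (rule independent_insertI)
    moreover have "insert x T \<subseteq> span E"
      using x T E by auto
    ultimately have "finite (insert x T) \<and> card (insert x T) \<le> card E"
      by (rule independent_span_bound[OF E(1)])
    moreover have "x \<notin> T"
      using nin span_base by blast
    ultimately show False
      using T(3) by auto
  qed
qed

lemma (in Vector_Spaces.linear) independent_if_independent_image:
  assumes "inj f" "vs2.independent (f ` X)"
  shows "vs1.independent X"
proof
  assume "vs1.dependent X"
  then obtain x where x: "x \<in> X" "x \<in> vs1.span (X - {x})"
    unfolding vs1.dependent_def by blast
  then have "f x \<in> vs2.span (f ` (X - {x}))"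
    by (simp add: span_image)
  also have "f ` (X - {x}) = f ` X - {f x}"
    using assms(1) by (auto simp: inj_def)
  finally show False
    using x(1) assms(2) unfolding vs2.dependent_def by blast
qed

lemma rational_span_subset_span:
  fixes s :: "'f::field_char_0 \<Rightarrow> 'b::ab_group_add \<Rightarrow> 'b" and t :: "rat \<Rightarrow> 'b \<Rightarrow> 'b"
  assumes s: "vector_space s" and t: "vector_space t" and st: "\<And>q x. t q x = s (of_rat q) x"
  shows "module.span t X \<subseteq> module.span s X"
proof -
  interpret s: vector_space s by (rule s)
  interpret t: vector_space t by (rule t)
  show ?thesis
    by (rule t.span_minimal)
      (auto simp: t.subspace_def st s.span_base s.span_zero s.span_add s.span_scale)
qed

text \<open>
  Extend \<open>T\<close> to a basis over \<open>\<rat>\<close> of the \<open>\<rat>\<close>-span of \<open>C\<close>. It has at most as many elements as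
  \<open>C\<close>, and its \<open>F\<close>-span contains the \<open>F\<close>-independent set \<open>C\<close>, so that none of its elements is
  redundant over \<open>F\<close>.
\<close>

lemma independent_in_rational_form:
  fixes s :: "'f::field_char_0 \<Rightarrow> 'b::ab_group_add \<Rightarrow> 'b" and t :: "rat \<Rightarrow> 'b \<Rightarrow> 'b"
  assumes s: "vector_space s" and t: "vector_space t" and st: "\<And>q x. t q x = s (of_rat q) x"
    and C: "finite C" "\<not> module.dependent s C"
    and T: "T \<subseteq> module.span t C" "\<not> module.dependent t T"
  shows "\<not> module.dependent s T"
proof -
  interpret s: vector_space s by (rule s)
  interpret t: vector_space t by (rule t)
  note sub = rational_span_subset_span[OF s t st]
  obtain T' where T': "T \<subseteq> T'" "T' \<subseteq> t.span C" "t.independent T'" "t.span C \<subseteq> t.span T'"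
    using t.maximal_independent_subset_extend[OF T] by blast
  have fin: "finite T'" "card T' \<le> card C"
    using t.independent_span_bound[OF C(1) T'(3,2)] by auto
  have "C \<subseteq> s.span T'"
    using T'(4) sub t.span_superset by blast
  then have "s.independent T'"
    using s.independent_if_spans_independent C(2) fin by blast
  then show ?thesis
    using T'(1) s.dependent_mono by blast
qed

section \<open>Rational forms of matrix algebras\<close>

interpretation mscale: vector_space mscale
  by (rule vector_space_mscale)

interpretation scaleQ_vec: vector_space scaleQ_vec
  by (rule vector_space_scaleQ_vec)

definition mscaleQ :: "rat \<Rightarrow> 'f::field_char_0^'n^'n \<Rightarrow> 'f^'n^'n" where
  "mscaleQ q M = mscale (of_rat q) M"

interpretation mscaleQ: vector_space mscaleQ
  by unfold_locales
    (simp_all add: mscaleQ_def mscale.scale_right_distrib mscale.scale_left_distrib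
      of_rat_add of_rat_mult)

lemma mscaleQ_span_subset: "mscaleQ.span X \<subseteq> mscale.span X"
  by (rule rational_span_subset_span[OF vector_space_mscale mscaleQ.vector_space_axioms mscaleQ_def])

text \<open>Square matrices are vectors with one coordinate for each pair of indices.\<close>

lemma elementary_matrix_basis:
  obtains E :: "('k::field^'n^'n) set"
  where "finite E" "card E = CARD('n) * CARD('n)" "mscale.independent E" "mscale.span E = UNIV"
proof -
  define h :: "'k^('n \<times> 'n) \<Rightarrow> 'k^'n^'n" where "h v = (\<chi> i k. v $ (i, k))" for v
  have lin: "Vector_Spaces.linear (*s) mscale h"
    by unfold_locales (simp_all add: h_def mscale_def vec_eq_iff)
  interpret h: Vector_Spaces.linear "(*s)" mscale h
    by (rule lin)
  have inj: "inj h"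
    by (rule injI) (simp add: h_def vec_eq_iff)
  have "h (\<chi> p. M $ fst p $ snd p) = M" for M
    by (simp add: h_def vec_eq_iff)
  then have surj: "range h = UNIV"
    by (rule surjI)
  show thesis
  proof
    show "finite (h ` cart_basis)"
      by (simp add: finite_cart_basis)
    show "card (h ` cart_basis) = CARD('n) * CARD('n)"
      using inj by (simp add: card_image inj_on_subset card_cart_basis)
    show "mscale.independent (h ` cart_basis)"
      by (rule h.independent_injective_image[OF independent_cart_basis])
        (use inj in \<open>auto intro: inj_on_subset\<close>)
    show "mscale.span (h ` cart_basis) = UNIV"
      by (simp add: h.span_image surj)
  qed
qed

lemma matrix_vector_mult_axis: "(M *v axis k 1) $ i = M $ i $ (k :: 'n::finite)"
  for M :: "'k::field^'n^'m"
  by (simp add: matrix_vector_mult_def axis_def if_distrib cong: if_cong)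

text \<open>The matrix \<open>u w\<^sup>T\<close>; for nonzero \<open>u\<close> and \<open>w\<close> these are the matrices of rank one.\<close>

definition outer :: "'k::field^'n \<Rightarrow> 'k^'n \<Rightarrow> 'k^'n^'n" where
  "outer u w = (\<chi> i k. u $ i * w $ k)"

lemma matrix_mult_outer: "M ** outer u w = outer (M *v u) w"
  by (simp add: outer_def matrix_matrix_mult_def matrix_vector_mult_def vec_eq_iff
      sum_distrib_right mult.assoc)

lemma outer_eq_0_iff: "w \<noteq> 0 \<Longrightarrow> outer u w = 0 \<longleftrightarrow> u = 0"
  by (auto simp: outer_def vec_eq_iff)

definition map_mat :: "('a \<Rightarrow> 'b) \<Rightarrow> 'a^'n^'n \<Rightarrow> 'b^'n^'n" where
  "map_mat f M = (\<chi> i k. f (M $ i $ k))"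

lemma mscale_mult_left: "mscale c M ** N = mscale c (M ** N)"
  and mscale_mult_right: "M ** mscale c N = mscale c (M ** N)"
  by (simp_all add: mscale_def matrix_matrix_mult_def vec_eq_iff sum_distrib_left algebra_simps)

lemma matrix_add_rdistrib: "(M + N) ** K = M ** K + N ** K"
  by (simp add: matrix_matrix_mult_def vec_eq_iff distrib_right sum.distrib)

lemma map_mat_of_rat:
  "map_mat of_rat (M + N) = map_mat of_rat M + map_mat of_rat N"
  "map_mat of_rat (M ** N) = map_mat of_rat M ** map_mat of_rat N"
  "map_mat of_rat (mscale q M) = mscaleQ q (map_mat of_rat M)"
  "map_mat of_rat (mat 1) = mat 1"
  by (simp_all add: map_mat_def vec_eq_iff matrix_matrix_mult_def mscaleQ_def mscale_def mat_def
      of_rat_add of_rat_mult of_rat_sum)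

text \<open>
  A rational form \<open>S\<close> of the matrix algebra is a central simple \<open>\<rat>\<close>-algebra that may well be a division
  algebra; a matrix of rank one in \<open>S\<close> excludes this. Since \<open>M (x w\<^sup>T) = (M x) w\<^sup>T\<close>, the set \<open>L\<close> of
  all \<open>x\<close> with \<open>x w\<^sup>T \<in> S\<close> is an \<open>S\<close>-module over \<open>\<rat>\<close>, isomorphic to the left ideal of all elements
  of \<open>S\<close> of this shape. It is a rational form of \<open>F\<^sup>n\<close>, and a \<open>\<rat>\<close>-basis of \<open>L\<close> is the
  basis with respect to which \<open>S\<close> becomes the algebra of rational matrices.
\<close>

lemma rational_form_conjugate:
  fixes C :: "('f::field_char_0^'n^'n) set"
  assumes C: "mscale.independent C" "mscale.span C = UNIV"
    and mult: "\<And>M N. M \<in> mscaleQ.span C \<Longrightarrow> N \<in> mscaleQ.span C \<Longrightarrow> M ** N \<in> mscaleQ.span C"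
    and rank1: "outer u w \<in> mscaleQ.span C" "u \<noteq> 0" "w \<noteq> 0"
  obtains P Q :: "'f^'n^'n" where "P ** Q = mat 1" "Q ** P = mat 1"
    "mscaleQ.span C = range (\<lambda>R. P ** map_mat of_rat R ** Q)"
proof -
  define S where "S = mscaleQ.span C"
  obtain E :: "('f^'n^'n) set" where E: "finite E" "card E = CARD('n) * CARD('n)"
    "mscale.independent E" "mscale.span E = UNIV"
    by (rule elementary_matrix_basis)
  have finC: "finite C" "card C = card E"
    using mscale.independent_span_bound[OF E(1) C(1)] mscale.independent_span_bound[OF _ E(3), of C]
      C(2) E(4) by auto
  define L where "L = {x. outer x w \<in> S}"
  interpret lin: Vector_Spaces.linear scaleQ_vec mscaleQ "\<lambda>x :: 'f^'n. outer x w"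
    by unfold_locales (simp_all add: outer_def mscaleQ_def mscale_def scaleQ_vec_def vec_eq_iff algebra_simps)
  interpret linF: Vector_Spaces.linear "(*s)" mscale "\<lambda>x :: 'f^'n. outer x w"
    by unfold_locales (simp_all add: outer_def mscale_def vec_eq_iff algebra_simps)
  have inj: "inj (\<lambda>x :: 'f^'n. outer x w)"
    using outer_eq_0_iff[OF rank1(3)] by (intro injI) (metis eq_iff_diff_eq_0 linF.diff)
  have stable: "M *v x \<in> L" if "M \<in> S" "x \<in> L" for M x
    using that mult by (simp add: L_def S_def flip: matrix_mult_outer)
  have subL: "scaleQ_vec.subspace L"
    using mscaleQ.subspace_span[of C]
    by (auto simp: scaleQ_vec.subspace_def mscaleQ.subspace_def L_def S_def lin.add lin.scale lin.zero)
  obtain b where b: "b \<subseteq> L" "scaleQ_vec.independent b" "L \<subseteq> scaleQ_vec.span b"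
    by (rule scaleQ_vec.basis_exists)
  \<comment> \<open>Independence of \<open>b\<close> over \<open>F\<close>: embed \<open>b\<close> into the rational form \<open>S\<close> and pull back.\<close>
  have "mscaleQ.independent ((\<lambda>x. outer x w) ` b)"
    by (rule lin.independent_injective_image[OF b(2) inj_on_subset[OF inj subset_UNIV]])
  moreover have "(\<lambda>x. outer x w) ` b \<subseteq> mscaleQ.span C"
    using b(1) by (auto simp: L_def S_def)
  ultimately have "mscale.independent ((\<lambda>x. outer x w) ` b)"
    by (intro independent_in_rational_form[OF vector_space_mscale mscaleQ.vector_space_axioms
          mscaleQ_def finC(1) C(1)])
  then have bF: "vec.independent b"
    by (rule linF.independent_if_independent_image[OF inj])
  have Lspan: "L \<subseteq> vec.span b"
  proof -
    have "scaleQ_vec.span b \<subseteq> vec.span b"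
      by (rule rational_span_subset_span[OF vec.vector_space_axioms vector_space_scaleQ_vec scaleQ_vec_def])
    then show ?thesis using b(3) by blast
  qed
  \<comment> \<open>\<open>S\<close> maps \<open>u\<close> into \<open>L\<close>, and over \<open>F\<close> it spans all matrices, which map \<open>u\<close> to every vector.\<close>
  have b_span: "vec.span b = UNIV"
  proof -
    interpret ev: Vector_Spaces.linear mscale "(*s)" "\<lambda>M :: 'f^'n^'n. M *v u"
      by unfold_locales
        (simp_all add: matrix_vector_mult_def mscale_def vec_eq_iff sum_distrib_left algebra_simps sum.distrib)
    have "y \<in> vec.span b" for y
    proof -
      obtain k where k: "u $ k \<noteq> 0"
        using rank1(2) by (auto simp: vec_eq_iff)
      have "outer y (axis k (1 / u $ k)) *v u = y"
        using k by (simp add: outer_def matrix_vector_mult_def vec_eq_iff axis_def if_distrib if_distribR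
            sum.delta cong: if_cong)
      moreover have "M *v u \<in> vec.span b" for M
      proof -
        have "(\<lambda>M. M *v u) ` C \<subseteq> L"
          using stable rank1(1) mscaleQ.span_base by (auto simp: L_def S_def)
        then have "vec.span ((\<lambda>M. M *v u) ` C) \<subseteq> vec.span b"
          using Lspan by (intro vec.span_minimal) auto
        then show ?thesis
          using ev.span_image[of C] C(2) by auto
      qed
      ultimately show ?thesis by metis
    qed
    then show ?thesis by auto
  qed
  have "card b = CARD('n)" "finite b"
    using vec.basis_card_eq_dim[of b UNIV] bF b_span vec.finiteI_independent by (auto simp: card_cart_basis)
  then obtain \<beta> :: "'n \<Rightarrow> 'f^'n" where \<beta>: "bij_betw \<beta> UNIV b"
    by (metis finite finite_same_card_bij)
  define P :: "'f^'n^'n" where "P = (\<chi> i k. \<beta> k $ i)"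
  have "columns P = b"
    using \<beta> by (auto simp: columns_def column_def P_def bij_betw_def)
  then obtain Q where Q: "P ** Q = mat 1"
    using matrix_right_invertible_span_columns[of P] b_span by auto
  then have Q': "Q ** P = mat 1"
    using matrix_left_right_inverse by blast
  have Pcol: "P *v axis k 1 = \<beta> k" for k
    by (simp add: vec_eq_iff matrix_vector_mult_axis P_def)
  \<comment> \<open>\<open>Q x\<close> is the vector of coordinates of \<open>x\<close> with respect to \<open>b\<close>.\<close>
  have Qrat: "\<forall>i. (Q *v x) $ i \<in> \<rat>" if "x \<in> L" for x
  proof -
    have "scaleQ_vec.span b \<subseteq> {x. \<forall>i. (Q *v x) $ i \<in> \<rat>}"
    proof (rule scaleQ_vec.span_minimal)
      show "b \<subseteq> {x. \<forall>i. (Q *v x) $ i \<in> \<rat>}"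
      proof
        fix x assume "x \<in> b"
        then obtain k where "x = P *v axis k 1"
          using \<beta> Pcol by (auto simp: bij_betw_def)
        then have "Q *v x = axis k 1"
          by (simp add: matrix_vector_mul_assoc Q')
        then show "x \<in> {x. \<forall>i. (Q *v x) $ i \<in> \<rat>}"
          by (simp add: axis_def)
      qed
    qed (auto simp: scaleQ_vec.subspace_def scaleQ_vec_def matrix_vector_right_distrib
        vector_scalar_commute)
    then show ?thesis using that b(3) by blast
  qed
  define \<gamma> :: "rat^'n^'n \<Rightarrow> 'f^'n^'n" where "\<gamma> R = P ** map_mat of_rat R ** Q" for R
  interpret \<gamma>: Vector_Spaces.linear mscale mscaleQ \<gamma>
    by unfold_locales
      (simp_all add: \<gamma>_def map_mat_of_rat matrix_add_ldistrib matrix_add_rdistrib mscaleQ_def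
        mscale_mult_left mscale_mult_right)
  have \<gamma>_inv: "Q ** \<gamma> R ** P = map_mat of_rat R" for R
    by (metis \<gamma>_def Q' matrix_mul_assoc matrix_mul_lid matrix_mul_rid)
  have inj_\<gamma>: "inj \<gamma>"
  proof (rule injI)
    fix R R' assume "\<gamma> R = \<gamma> R'"
    then have "map_mat of_rat R = (map_mat of_rat R' :: 'f^'n^'n)"
      by (metis \<gamma>_inv)
    then show "R = R'" by (simp add: map_mat_def vec_eq_iff)
  qed
  have S_sub: "S \<subseteq> range \<gamma>"
  proof
    fix M assume M: "M \<in> S"
    have "\<exists>q. (Q ** M ** P) $ i $ k = of_rat q" for i k
    proof -
      have "\<beta> k \<in> L" using \<beta> b(1) by (auto simp: bij_betw_def)
      then have "(Q *v (M *v (P *v axis k 1))) $ i \<in> \<rat>"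
        using Qrat stable[OF M] by (simp add: Pcol)
      moreover have "(Q *v (M *v (P *v axis k 1))) $ i = (Q ** M ** P) $ i $ k"
        by (simp add: matrix_vector_mul_assoc matrix_mul_assoc matrix_vector_mult_axis)
      ultimately show ?thesis by (auto elim: Rats_cases)
    qed
    then obtain r where r: "\<And>i k. (Q ** M ** P) $ i $ k = of_rat (r i k)"
      by metis
    then have "Q ** M ** P = map_mat of_rat (\<chi> i k. r i k)"
      by (simp add: map_mat_def vec_eq_iff)
    then have "\<gamma> (\<chi> i k. r i k) = M"
      by (metis \<gamma>_def Q matrix_mul_assoc matrix_mul_lid matrix_mul_rid)
    then show "M \<in> range \<gamma>" by blast
  qed
  \<comment> \<open>The preimage of \<open>C\<close> is independent and has as many elements as there are matrix entries, so that
    it spans the rational matrices.\<close>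
  then obtain D where D: "C = \<gamma> ` D"
    by (metis S_def mscaleQ.span_superset order_trans subset_imageE)
  have cardD: "card D = CARD('n) * CARD('n)"
    using D finC E(2) inj_\<gamma> by (metis card_image inj_on_subset subset_UNIV)
  have "mscaleQ.independent C"
  proof
    assume "mscaleQ.dependent C"
    then obtain c where c: "c \<in> C" "c \<in> mscaleQ.span (C - {c})"
      unfolding mscaleQ.dependent_def by blast
    have "mscaleQ.span (C - {c}) \<subseteq> mscale.span (C - {c})"
      by (rule mscaleQ_span_subset)
    then show False using c C(1) unfolding mscale.dependent_def by blast
  qed
  then have D_ind: "mscale.independent D"
    unfolding D by (rule \<gamma>.independent_if_independent_image[OF inj_\<gamma>])
  obtain E' :: "(rat^'n^'n) set" where E': "finite E'" "card E' = CARD('n) * CARD('n)"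
    "mscale.independent E'" "mscale.span E' = UNIV"
    by (rule elementary_matrix_basis)
  have "mscale.span D = UNIV"
    using mscale.spans_if_independent_card[OF E'(1), of UNIV D] E' D_ind cardD by auto
  then have "S = range \<gamma>"
    unfolding S_def D by (simp add: \<gamma>.span_image)
  then show thesis
    using that[OF Q Q'] by (simp add: S_def \<gamma>_def[abs_def])
qed

section \<open>Simple Lie algebras over the rationals\<close>

lemma bracket_zero_left: "bracket 0 y = (0 :: 'g::rat_lie_algebra)"
  by (metis add_cancel_right_right bracket_add_left)

lemma bracket_swap: "bracket y x = - bracket x (y :: 'g::rat_lie_algebra)"
proof -
  have "0 = bracket (x + y) (x + y)"
    by (simp only: bracket_self)
  also have "\<dots> = bracket x y + bracket y x"
    by (simp only: bracket_add_left bracket_add_right) (simp add: bracket_self)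
  finally show ?thesis
    by (metis add.commute eq_neg_iff_add_eq_0)
qed

lemma simple_lie_algebra_nonabelian:
  "simple_lie_algebra TYPE('g::rat_lie_algebra) \<Longrightarrow> \<exists>x y :: 'g. bracket x y \<noteq> 0"
  by (simp add: simple_lie_algebra_def)

lemma simple_lie_algebra_ideal:
  "simple_lie_algebra TYPE('g::rat_lie_algebra) \<Longrightarrow> lie_ideal I \<Longrightarrow> I = {0} \<or> I = (UNIV :: 'g set)"
  by (simp add: simple_lie_algebra_def)

text \<open>The centre is an ideal, and it is not everything because some bracket is nonzero.\<close>

lemma simple_lie_algebra_centerless:
  fixes x :: "'g::rat_lie_algebra"
  assumes simple: "simple_lie_algebra TYPE('g)" and x: "\<And>y. bracket x y = 0"
  shows "x = 0"
proof -
  define Z where "Z = {x :: 'g. \<forall>y. bracket x y = 0}"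
  have "lie_ideal Z"
    unfolding lie_ideal_def
  proof (intro conjI allI ballI)
    show "rat_vector.subspace Z"
      by (auto simp: rat_vector.subspace_def Z_def bracket_add_left bracket_scaleQ_left bracket_zero_left)
    fix u z assume "z \<in> Z"
    then have "bracket u z = 0"
      by (simp add: Z_def bracket_swap[of u z])
    then show "bracket u z \<in> Z"
      by (simp add: Z_def bracket_zero_left)
  qed
  then have "Z = {0} \<or> Z = UNIV"
    by (rule simple_lie_algebra_ideal[OF simple])
  then show ?thesis
    using simple_lie_algebra_nonabelian[OF simple] x by (auto simp: Z_def)
qed

section \<open>Algebras that are the sum of the scalars and a simple Lie algebra\<close>

lemma trace_mscale: "trace (mscale q M) = q * trace M"
  by (simp add: trace_def mscale_def sum_distrib_left)

text \<open>
  An associative algebra \<open>A = \<rat> \<oplus> r(\<gg>)\<close> whose commutator restricts to the bracket of \<open>\<gg>\<close>. The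
  condition on products states that \<open>r(\<gg>)\<close> is not itself an associative subalgebra: a product of two of its
  elements may have a scalar part.
\<close>

locale lie_scalar_algebra = assoc_algebra scale mult one A
  for scale :: "rat \<Rightarrow> 'a::ab_group_add \<Rightarrow> 'a" and mult :: "'a \<Rightarrow> 'a \<Rightarrow> 'a" and one A +
  fixes r :: "'g::rat_lie_algebra \<Rightarrow> 'a"
  assumes simple: "simple_lie_algebra TYPE('g)"
    and r_linear: "Vector_Spaces.linear scaleQ scale r"
    and r_bracket: "r (bracket x y) = mult (r x) (r y) - mult (r y) (r x)"
    and A_eq: "A = {scale q one + r x | q x. True}"
    and scalar_in_range: "scale q one = r x \<Longrightarrow> q = 0"
    and product_not_in_range: "\<exists>x y. mult (r x) (r y) \<notin> range r"
    and finite_dim_lie: "\<exists>X :: 'g set. finite X \<and> rat_vector.span X = UNIV"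
begin

sublocale r: Vector_Spaces.linear scaleQ scale r
  by (rule r_linear)

lemma r_in_A: "r x \<in> A"
  unfolding A_eq using scale_zero_left add_0 by (metis (mono_tags, lifting) mem_Collect_eq)

lemma scalar_in_A: "scale q one \<in> A"
  using carrier_subspace one_closed by (rule subspace_scale)

lemma A_cases:
  assumes "a \<in> A"
  obtains q x where "a = scale q one + r x"
  using assms unfolding A_eq by blast

lemma mult_zero: "x \<in> A \<Longrightarrow> mult 0 x = 0" "x \<in> A \<Longrightarrow> mult x 0 = 0"
  using mult_scale_left[of x x 0] mult_scale_right[of x x 0] by simp_all

text \<open>
  The kernel of \<open>r\<close> is an ideal of \<open>\<gg>\<close>, and \<open>r\<close> does not vanish because otherwise all products would be
  \<open>0\<close> and lie in the range of \<open>r\<close>.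
\<close>

lemma r_eq_0_iff: "r x = 0 \<longleftrightarrow> x = 0"
proof
  assume "r x = 0"
  have "lie_ideal {x. r x = 0}"
    by (auto simp: lie_ideal_def r.subspace_kernel r_bracket mult_zero r_in_A)
  then have "{x. r x = 0} = {0} \<or> {x. r x = 0} = UNIV"
    by (rule simple_lie_algebra_ideal[OF simple])
  moreover have "{x. r x = 0} \<noteq> UNIV"
  proof
    assume "{x. r x = 0} = UNIV"
    then have "r x = 0" for x
      by blast
    then show False
      using product_not_in_range mult_zero r_in_A by (metis rangeI)
  qed
  ultimately show "x = 0"
    using \<open>r x = 0\<close> by blast
qed simp

lemma r_inj: "inj r"
  by (rule injI) (metis r_eq_0_iff r.diff right_minus_eq)

text \<open>Scalars commute with everything, so that commutators only see the \<open>\<gg>\<close>-part.\<close>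

lemma commutator_scalar_plus:
  "mult (scale q one + r x) (r y) - mult (r y) (scale q one + r x) = r (bracket x y)"
  by (simp add: mult_add_left mult_add_right r_in_A scalar_in_A mult_scale_left mult_scale_right
      one_closed one_left one_right r_bracket)

lemma center_scalar: "center = range (\<lambda>q. scale q one)"
proof
  show "center \<subseteq> range (\<lambda>q. scale q one)"
  proof
    fix z assume z: "z \<in> center"
    then obtain q x where zq: "z = scale q one + r x"
      unfolding center_def by (blast elim: A_cases)
    have "bracket x y = 0" for y
    proof -
      have "mult z (r y) = mult (r y) z"
        using z r_in_A unfolding center_def by blast
      then have "r (bracket x y) = 0"
        unfolding commutator_scalar_plus[of q x y, symmetric] zq[symmetric] by simp
      then show ?thesis
        by (simp add: r_eq_0_iff)
    qed
    then have "x = 0"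
      by (rule simple_lie_algebra_centerless[OF simple])
    then show "z \<in> range (\<lambda>q. scale q one)"
      by (auto simp: zq)
  qed
  show "range (\<lambda>q. scale q one) \<subseteq> center"
    by (auto simp: center_def scalar_in_A mult_scale_left mult_scale_right one_closed one_left one_right)
qed

lemma ideal_with_scalar:
  assumes I: "two_sided_ideal I" and q: "scale q one \<in> I" "q \<noteq> 0"
  shows "I = A"
proof -
  have "scale (1 / q) (scale q one) \<in> I"
    using I q(1) unfolding two_sided_ideal_def by (blast intro: subspace_scale)
  then have "one \<in> I"
    using q(2) by simp
  then have "a \<in> I" if "a \<in> A" for a
    using I that one_right unfolding two_sided_ideal_def by metis
  with I show ?thesis
    unfolding two_sided_ideal_def by blast
qed

text \<open>
  An ideal of \<open>A\<close> pulls back to an ideal of \<open>\<gg>\<close>. If the latter is zero, then commutators of elements of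
  \<open>I\<close> with \<open>r(\<gg>)\<close> vanish, so that \<open>I\<close> contains only scalars. If it is everything, then a product with a
  nonzero scalar part yields a nonzero scalar in \<open>I\<close>.
\<close>

lemma ideal_trivial:
  assumes I: "two_sided_ideal I"
  shows "I = {0} \<or> I = A"
proof -
  have sub: "subspace I" and mem: "\<And>a x. a \<in> A \<Longrightarrow> x \<in> I \<Longrightarrow> mult a x \<in> I \<and> mult x a \<in> I"
    and IA: "I \<subseteq> A"
    using I unfolding two_sided_ideal_def by blast+
  define J where "J = {x. r x \<in> I}"
  have "lie_ideal J"
    using mem r_in_A
    by (auto simp: lie_ideal_def J_def r.subspace_linear_preimage sub r_bracket intro: subspace_diff[OF sub])
  then consider "J = {0}" | "J = UNIV"
    using simple_lie_algebra_ideal[OF simple] by blast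
  then show ?thesis
  proof cases
    case 1
    have scalar: "\<exists>q. a = scale q one" if a: "a \<in> I" for a
    proof -
      obtain q x where ax: "a = scale q one + r x"
        using a IA A_cases by blast
      have "bracket x y = 0" for y
      proof -
        have "r (bracket x y) \<in> I"
          unfolding commutator_scalar_plus[of q x y, symmetric] ax[symmetric]
          using a mem r_in_A by (blast intro: subspace_diff[OF sub])
        then show ?thesis
          using 1 by (auto simp: J_def)
      qed
      then have "x = 0"
        by (rule simple_lie_algebra_centerless[OF simple])
      with ax show ?thesis by auto
    qed
    show ?thesis
    proof (cases "I = A")
      case False
      have "a = 0" if "a \<in> I" for a
        using scalar[OF that] that False ideal_with_scalar[OF I] by force
      then show ?thesis
        using subspace_0[OF sub] by blast
    qed simp
  next
    case 2
    obtain x y where xy: "mult (r x) (r y) \<notin> range r"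
      using product_not_in_range by blast
    obtain q z where qz: "mult (r x) (r y) = scale q one + r z"
      using mult_closed[OF r_in_A r_in_A] by (rule A_cases)
    with xy have "q \<noteq> 0"
      by auto
    have rI: "r w \<in> I" for w
      using 2 unfolding J_def by blast
    have "scale q one = mult (r x) (r y) - r z"
      by (simp add: qz)
    also have "\<dots> \<in> I"
      using rI mem r_in_A by (blast intro: subspace_diff[OF sub])
    finally show ?thesis
      using ideal_with_scalar[OF I] \<open>q \<noteq> 0\<close> by blast
  qed
qed

theorem central_simple: "central_simple_algebra scale mult one A"
proof
  obtain X :: "'g set" where X: "finite X" "rat_vector.span X = UNIV"
    using finite_dim_lie by blast
  have "x \<in> span (insert one (r ` X)) \<longleftrightarrow> (\<exists>q. x - scale q one \<in> range r)" for x
    by (simp add: span_breakdown_eq r.span_image X(2))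
  also have "\<dots> x \<longleftrightarrow> x \<in> A" for x
    unfolding A_eq by (auto simp: image_iff algebra_simps)
  finally show "\<exists>S. finite S \<and> span S = A"
    using X(1) by (intro exI[of _ "insert one (r ` X)"]) auto
  show "one \<noteq> 0"
    using scalar_in_range[of 1 0] by auto
qed (fact center_scalar, fact ideal_trivial)

text \<open>
  The elements \<open>x\<close> with \<open>trace (f (r x)) = 0\<close> form an ideal, since brackets are mapped to commutators; it
  contains all brackets, hence is \<open>\<gg>\<close>. Conversely, the preimage of a trace-zero matrix under \<open>f\<close> has no
  scalar part, because a scalar \<open>q\<close> would contribute \<open>n q\<close> to the trace.
\<close>

theorem lie_iso_of_matrix_iso:
  fixes f :: "'a \<Rightarrow> rat^'n^'n"
  assumes f: "algebra_iso_matrix scale mult one A f"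
  shows "lie_iso_sl scaleQ bracket (\<lambda>x. f (r x))"
proof -
  have bij: "bij_betw f A UNIV" and f_one: "f one = mat 1"
    and f_add: "\<And>x y. x \<in> A \<Longrightarrow> y \<in> A \<Longrightarrow> f (x + y) = f x + f y"
    and f_mult: "\<And>x y. x \<in> A \<Longrightarrow> y \<in> A \<Longrightarrow> f (mult x y) = f x ** f y"
    and f_scale: "\<And>c x. x \<in> A \<Longrightarrow> f (scale c x) = mscale c (f x)"
    using f unfolding algebra_iso_matrix_def by blast+
  define F where "F x = f (r x)" for x
  interpret F: Vector_Spaces.linear scaleQ mscale F
    by unfold_locales (simp_all add: F_def r.add r.scale f_add f_scale r_in_A)
  have F_bracket: "F (bracket x y) = commutator (F x) (F y)" for x y
  proof -
    have "mult (r x) (r y) = r (bracket x y) + mult (r y) (r x)"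
      by (simp add: r_bracket)
    then have "F x ** F y = F (bracket x y) + F y ** F x"
      unfolding F_def by (metis f_add f_mult mult_closed r_in_A)
    then show ?thesis
      by (simp add: commutator_def)
  qed
  have trace_bracket: "trace (F (bracket x y)) = 0" for x y
    by (simp add: F_bracket commutator_def trace_sub trace_mul_sym[of "F x"])
  have "lie_ideal {x. trace (F x) = 0}"
    by (auto simp: lie_ideal_def rat_vector.subspace_def F.add F.scale F.zero trace_add trace_mscale
        trace_bracket trace_0[unfolded mat_0])
  then have "{x. trace (F x) = 0} = {0} \<or> {x. trace (F x) = 0} = UNIV"
    by (rule simple_lie_algebra_ideal[OF simple])
  then have trace: "trace (F x) = 0" for x
    using simple_lie_algebra_nonabelian[OF simple] trace_bracket by blast
  have "inj F"
    using r_inj bij r_in_A unfolding F_def by (auto simp: inj_def bij_betw_def inj_on_def)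
  moreover have "M \<in> range F" if M: "M \<in> sl" for M
  proof -
    obtain a where "a \<in> A" "f a = M"
      using bij by (metis UNIV_I bij_betw_iff_bijections)
    moreover from this obtain q x where "a = scale q one + r x"
      by (blast elim: A_cases)
    ultimately have Mq: "M = mscale q (mat 1) + F x"
      by (simp add: F_def f_add f_scale f_one r_in_A scalar_in_A one_closed)
    then have "q * of_nat CARD('n) = 0"
      using M trace by (simp add: sl_def trace_add trace_mscale trace_I)
    then show ?thesis
      using Mq by auto
  qed
  ultimately show ?thesis
    unfolding lie_iso_sl_def F_def[symmetric]
    using F_bracket trace F.linear_axioms by (auto simp: bij_betw_def sl_def)
qed

text \<open>
  The square of a root vector is zero. Take \<open>e\<close> and \<open>d\<close> corresponding to \<open>E\<^sub>i\<^sub>k\<close> and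
  \<open>E\<^sub>i\<^sub>i - E\<^sub>k\<^sub>k\<close>. Then \<open>[d, e] = 2 e\<close>, and therefore the commutator of \<open>r d\<close> with \<open>(r e)\<^sup>2\<close> is
  \<open>4 (r e)\<^sup>2\<close>. The eigenvalues of \<open>ad d\<close> on \<open>sl\<^sub>n\<close> are differences of two of the
  numbers \<open>1, -1, 0\<close>, so that \<open>4\<close> is not among them.
\<close>

theorem square_zero_of_lie_iso:
  fixes g :: "'g \<Rightarrow> rat^'n^'n" and i k :: 'n
  assumes g: "lie_iso_sl scaleQ bracket g" and ik: "i \<noteq> k"
  obtains n where "n \<in> A" "n \<noteq> 0" "mult n n = 0"
proof -
  interpret g: Vector_Spaces.linear scaleQ mscale g
    using g unfolding lie_iso_sl_def by blast
  have g_bracket: "\<And>x y. g (bracket x y) = commutator (g x) (g y)" and bij: "bij_betw g UNIV sl"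
    using g unfolding lie_iso_sl_def by blast+
  have inj: "g x = g y \<Longrightarrow> x = y" for x y
    using bij by (auto simp: bij_betw_def inj_def)
  define h :: "'n \<Rightarrow> rat" where "h a = (if a = i then 1 else if a = k then -1 else 0)" for a
  define D :: "rat^'n^'n" where "D = (\<chi> a b. if a = b then h a else 0)"
  define E :: "rat^'n^'n" where "E = (\<chi> a b. if a = i \<and> b = k then 1 else 0)"
  \<comment> \<open>\<open>D\<close> is diagonal with entries \<open>h\<close>; matrix units are eigenvectors of its commutator.\<close>
  have weight: "commutator D M = (\<chi> a b. (h a - h b) * M $ a $ b)" for M
    by (simp add: commutator_def D_def matrix_matrix_mult_def vec_eq_iff if_distrib if_distribR algebra_simps
        cong: if_cong)
  have "trace D = (\<Sum>a\<in>{i, k}. h a)"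
    unfolding trace_def D_def by (simp, rule sum.mono_neutral_right) (auto simp: h_def)
  then have D_sl: "D \<in> sl" 
    using ik by (simp add: sl_def h_def)
  have E_sl: "E \<in> sl"
    using ik by (auto simp: sl_def trace_def E_def intro!: sum.neutral)
  obtain d e where d: "g d = D" and e: "g e = E"
    using D_sl E_sl bij by (metis bij_betw_iff_bijections)
  have "g (bracket d e) = g (scaleQ 2 e)"
    using ik by (simp add: g_bracket g.scale d e weight mscale_def E_def h_def vec_eq_iff)
  then have "r (bracket d e) = scale 2 (r e)"
    using inj by (metis r.scale)
  then have de: "mult (r d) (r e) = mult (r e) (r d) + scale 2 (r e)"
    by (simp add: r_bracket algebra_simps)
  have dA: "r d \<in> A" and eA: "r e \<in> A"
    by (rule r_in_A)+
  have "mult (r d) (mult (r e) (r e)) = mult (mult (r e) (r d) + scale 2 (r e)) (r e)"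
    using dA eA by (simp add: mult_assoc[symmetric] de)
  also have "\<dots> = mult (r e) (mult (r e) (r d) + scale 2 (r e)) + scale 2 (mult (r e) (r e))"
    using dA eA
    by (simp add: mult_add_left mult_closed subspace_scale[OF carrier_subspace] mult_assoc de mult_scale_left)
  also have "\<dots> = mult (mult (r e) (r e)) (r d) + scale 4 (mult (r e) (r e))"
    using dA eA scale_left_distrib[of 2 2 "mult (r e) (r e)"]
    by (simp add: mult_add_right mult_closed subspace_scale[OF carrier_subspace] mult_assoc mult_scale_right
       add.assoc)
  finally have dee: "mult (r d) (mult (r e) (r e)) - mult (mult (r e) (r e)) (r d) = scale 4 (mult (r e) (r e))"
    by simp
  \<comment> \<open>Write the square as \<open>q + r y\<close>; its commutator with \<open>r d\<close> has no scalar part, so that \<open>4 q = 0\<close>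
    and \<open>y\<close> would be an eigenvector of \<open>ad d\<close> for the eigenvalue \<open>4\<close>.\<close>
  obtain q y where qy: "mult (r e) (r e) = scale q one + r y"
    using mult_closed[OF eA eA] by (rule A_cases)
  have "- r (bracket y d) = scale 4 (scale q one + r y)"
    using commutator_scalar_plus[of q y d] dee unfolding qy by (metis minus_diff_eq)
  then have "scale (4 * q) one = r (bracket d y - scaleQ 4 y)"
    by (simp add: bracket_swap[of d y] r.diff r.scale r.neg scale_right_distrib algebra_simps)
  then have "q = 0" and "r (bracket d y - scaleQ 4 y) = 0"
    using scalar_in_range[of "4 * q"] by auto
  then have "bracket d y = scaleQ 4 y"
    by (simp add: r_eq_0_iff)
  then have "commutator D (g y) = mscale 4 (g y)"
    by (metis d g_bracket g.scale)
  then have "(h a - h b) * g y $ a $ b = 4 * g y $ a $ b" for a b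
    by (simp add: weight mscale_def vec_eq_iff)
  moreover have "h a - h b \<noteq> 4" for a b
    by (simp add: h_def)
  ultimately have "g y = 0"
    by (simp add: vec_eq_iff)
  then have "y = 0"
    using inj g.zero by metis
  have "E $ i $ k \<noteq> 0"
    by (simp add: E_def)
  then have "e \<noteq> 0"
    using e g.zero by (metis zero_index)
  then have "r e \<noteq> 0"
    by (simp add: r_eq_0_iff)
  then show thesis
    using that[OF eA] qy \<open>q = 0\<close> \<open>y = 0\<close> by simp
qed

end

section \<open>Matrices of square zero\<close>

text \<open>
  If \<open>u = N x\<close> and \<open>v = N y\<close> were independent, then so would be \<open>y, x, v, u\<close>, because \<open>N\<close> annihilates
  \<open>u\<close> and \<open>v\<close>; four independent vectors do not fit into dimension three. Hence all columns of \<open>N\<close> are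
  multiples of \<open>u\<close>.
\<close>

lemma square_zero_rank_one:
  fixes N :: "'k::field^'n^'n"
  assumes card: "CARD('n) \<le> 3" and N: "N \<noteq> 0" "N ** N = 0"
  obtains u w where "N = outer u w" "u \<noteq> 0" "w \<noteq> 0"
proof -
  have entry: "N $ a $ b = (N *v axis b 1) $ a" for a b
    by (simp add: matrix_vector_mult_axis)
  have NN: "N *v (N *v z) = 0" for z
    by (simp add: matrix_vector_mul_assoc N(2))
  obtain x where x: "N *v x \<noteq> 0"
    using N(1) entry by (metis vec_eq_iff zero_index)
  define u where "u = N *v x"
  have in_span: "N *v y \<in> vec.span {u}" for y
  proof (rule ccontr)
    define v where "v = N *v y"
    assume "N *v y \<notin> vec.span {u}"
    then have v: "v \<notin> vec.span {u}"
      by (simp add: v_def)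
    have ker: "N *v z = 0" if "z \<in> vec.span {v, u}" for z
    proof -
      have "vec.span {v, u} \<subseteq> {z. N *v z = 0}"
        by (rule vec.span_minimal)
          (auto simp: u_def v_def NN vec.subspace_def matrix_vector_right_distrib vector_scalar_commute)
      with that show ?thesis by blast
    qed
    have x': "x \<notin> vec.span {v, u}"
      using ker x by blast
    have y': "y \<notin> vec.span {x, v, u}"
    proof
      assume "y \<in> vec.span {x, v, u}"
      then obtain c where "y - c *s x \<in> vec.span {v, u}"
        unfolding vec.span_breakdown_eq[of y] by blast
      then have "N *v (y - c *s x) = 0"
        by (rule ker)
      moreover have "y = (y - c *s x) + c *s x"
        by simp
      ultimately have "v = c *s u"
        unfolding u_def v_def by (metis add_0 matrix_vector_right_distrib vector_scalar_commute)
      then show False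
        using v vec.span_scale vec.span_base by blast
    qed
    have "vec.independent {u}"
      using x by (simp add: u_def)
    then have "vec.independent {y, x, v, u}"
      by (rule vec.independent_insertI[OF y' vec.independent_insertI[OF x' vec.independent_insertI[OF v]]])
    then have "card {y, x, v, u} \<le> CARD('n)"
      using vec.independent_span_bound[OF finite_cart_basis, of "{y, x, v, u}"] by (simp add: card_cart_basis)
    moreover have "card {y, x, v, u} = 4"
    proof -
      have "v \<noteq> u"
        using v vec.span_base by blast
      moreover have "x \<noteq> v" "x \<noteq> u"
        using x' vec.span_base[of _ "{v, u}"] by blast+
      moreover have "y \<noteq> x" "y \<noteq> v" "y \<noteq> u"
        using y' vec.span_base[of _ "{x, v, u}"] by blast+
      ultimately show ?thesis by simp
    qed
    ultimately show False
      using card by simp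
  qed
  then have "\<forall>b. \<exists>c. N *v axis b 1 = c *s u"
    by (auto simp: vec.span_singleton)
  then obtain c where c: "\<And>b. N *v axis b 1 = c b *s u"
    by metis
  have eq: "N = outer u (\<chi> b. c b)"
    by (simp add: vec_eq_iff entry c outer_def mult.commute)
  have "(\<chi> b. c b) \<noteq> 0"
  proof
    assume "(\<chi> b. c b) = 0"
    then have "N = 0"
      by (simp add: eq outer_def vec_eq_iff)
    with N(1) show False ..
  qed
  then show thesis
    using that[OF eq] x u_def by simp
qed

section \<open>The rational representation\<close>

lemma sl_span_pure_tensors:
  fixes \<Phi> :: "('f::field_char_0, 'g::rat_lie_algebra) tensor \<Rightarrow> 'f^'n^'n"
  assumes "lie_iso_sl scaleK bracketK \<Phi>"
  shows "sl \<subseteq> mscale.span (range (\<lambda>x. \<Phi> (pure_tensor 1 x)))"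
proof -
  interpret \<Phi>: Vector_Spaces.linear scaleK mscale \<Phi>
    using assms unfolding lie_iso_sl_def by blast
  have "\<Phi> t \<in> mscale.span (range (\<lambda>x. \<Phi> (pure_tensor 1 x)))" for t
  proof (induction t rule: tensor_induct)
    case (pure a v)
    have "\<Phi> (pure_tensor a v) = mscale a (\<Phi> (pure_tensor 1 v))"
      by (simp flip: \<Phi>.scale add: scaleK_pure)
    then show ?case
      by (simp add: mscale.span_scale mscale.span_base)
  qed (simp_all add: \<Phi>.diff mscale.span_zero mscale.span_diff)
  then have "range \<Phi> \<subseteq> mscale.span (range (\<lambda>x. \<Phi> (pure_tensor 1 x)))"
    by blast
  then show ?thesis
    using assms by (simp add: lie_iso_sl_def bij_betw_def)
qed

text \<open>
  The trace form is bilinear; if it vanished on \<open>S\<close>, it would vanish on trace-zero matrices, but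
  \<open>trace (E\<^sub>i\<^sub>k E\<^sub>k\<^sub>i) = 1\<close>.
\<close>

lemma trace_form_nonzero:
  fixes S :: "('k::field^'n^'n) set" and i k :: 'n
  assumes S: "sl \<subseteq> mscale.span S" and ik: "i \<noteq> k"
  shows "\<exists>X\<in>S. \<exists>Y\<in>S. trace (X ** Y) \<noteq> 0"
proof (rule ccontr)
  assume "\<not> ?thesis"
  then have zero: "trace (X ** Y) = 0" if "X \<in> S" "Y \<in> S" for X Y
    using that by blast
  have zero': "trace (X ** Y) = 0" if X: "X \<in> S" and Y: "Y \<in> sl" for X Y :: "'k^'n^'n"
  proof -
    have "mscale.span S \<subseteq> {Y. trace (X ** Y) = 0}"
      using X by (intro mscale.span_minimal)
        (auto simp: zero mscale.subspace_def matrix_add_ldistrib trace_add mscale_mult_right trace_mscale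
          trace_0[unfolded mat_0])
    with S Y show ?thesis by blast
  qed
  have zero'': "trace (X ** Y) = 0" if X: "X \<in> sl" and Y: "Y \<in> sl" for X Y :: "'k^'n^'n"
  proof -
    have "mscale.span S \<subseteq> {X. trace (X ** Y) = 0}"
      using Y by (intro mscale.span_minimal)
        (auto simp: zero' mscale.subspace_def matrix_add_rdistrib trace_add mscale_mult_left trace_mscale
          trace_0[unfolded mat_0])
    with S X show ?thesis by blast
  qed
  define E :: "'n \<Rightarrow> 'n \<Rightarrow> 'k^'n^'n" where "E p q = outer (axis p 1) (axis q 1)" for p q
  have "E i k \<in> sl" "E k i \<in> sl"
    using ik by (auto simp: E_def sl_def trace_def outer_def axis_def intro!: sum.neutral)
  then have "trace (E i k ** E k i) = 0"
    by (rule zero'')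
  moreover have "outer (axis i 1) (axis k 1) *v axis k 1 = (axis i 1 :: 'k^'n)"
    by (simp add: vec_eq_iff matrix_vector_mult_axis) (simp add: outer_def)
  then have "E i k ** E k i = outer (axis i 1) (axis i 1)"
    by (simp add: E_def matrix_mult_outer)
  moreover have "trace (outer (axis i 1) (axis i (1::'k))) = (\<Sum>a\<in>UNIV. if a = i then 1 else 0)"
    unfolding trace_def outer_def axis_def by (rule sum.cong) auto
  ultimately show False by simp
qed

text \<open>
  A matrix \<open>M\<close> as an endomorphism of the rational space that \<open>\<phi>\<close> identifies with \<open>F\<^sup>n\<close>. This
  embeds the \<open>\<rat>\<close>-algebra \<open>M\<^sub>n(F)\<close> into the algebra of \<open>\<rat>\<close>-linear endomorphisms; the rational
  representation takes its values in the image.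
\<close>

definition transport :: "('v \<Rightarrow> 'f::field^'n) \<Rightarrow> 'f^'n^'n \<Rightarrow> 'v \<Rightarrow> 'v" where
  "transport \<phi> M = inv \<phi> \<circ> (\<lambda>v. M *v v) \<circ> \<phi>"

lemma
  fixes \<phi> :: "'v::rat_vector \<Rightarrow> 'f::field_char_0^'n"
  assumes \<phi>: "Vector_Spaces.linear scaleQ scaleQ_vec \<phi>" "bij \<phi>"
  shows transport_linear: "Vector_Spaces.linear mscaleQ scaleQ (transport \<phi>)"
    and transport_inj: "inj (transport \<phi>)"
    and transport_mult: "transport \<phi> (M ** N) = transport \<phi> M \<circ> transport \<phi> N"
    and transport_one: "transport \<phi> (mat 1) = id"
    and transport_apply_add: "transport \<phi> M (v + w) = transport \<phi> M v + transport \<phi> M w"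
    and transport_apply_scale: "transport \<phi> M (scaleQ q v) = scaleQ q (transport \<phi> M v)"
proof -
  interpret \<phi>: Vector_Spaces.linear scaleQ scaleQ_vec \<phi>
    by (rule \<phi>)
  have inv_\<phi> [simp]: "\<phi> (inv \<phi> x) = x" "inv \<phi> (\<phi> v) = v" for x v
    using \<phi>(2) by (simp_all add: bij_is_surj bij_is_inj surj_f_inv_f)
  have char: "transport \<phi> M v = w \<longleftrightarrow> M *v \<phi> v = \<phi> w" for M v w
    by (metis comp_apply inv_\<phi> transport_def)
  have \<phi>_transport: "\<phi> (transport \<phi> M v) = M *v \<phi> v" for M v
    by (simp add: transport_def)
  show "Vector_Spaces.linear mscaleQ scaleQ (transport \<phi>)"
  proof unfold_locales
    fix M N :: "'f^'n^'n" and q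
    show "transport \<phi> (M + N) = transport \<phi> M + transport \<phi> N"
      by (simp add: fun_eq_iff char \<phi>.add \<phi>_transport matrix_vector_mult_add_rdistrib)
    have "mscaleQ q M *v x = scaleQ_vec q (M *v x)" for x
      by (simp add: mscaleQ_def mscale_def scaleQ_vec_def matrix_vector_mult_def vec_eq_iff
          sum_distrib_left mult.assoc)
    then show "transport \<phi> (mscaleQ q M) = scaleQ q (transport \<phi> M)"
      by (simp add: fun_eq_iff scaleQ_fun_def char \<phi>.scale \<phi>_transport)
  qed
  show "inj (transport \<phi>)"
  proof (rule injI)
    fix M N :: "'f^'n^'n" assume "transport \<phi> M = transport \<phi> N"
    then have "M *v \<phi> v = N *v \<phi> v" for v
      by (metis \<phi>_transport)
    then have "M *v x = N *v x" for x
      by (metis inv_\<phi>(1))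
    then show "M = N"
      by (simp add: matrix_eq)
  qed
  show "transport \<phi> (M ** N) = transport \<phi> M \<circ> transport \<phi> N"
    by (simp add: transport_def fun_eq_iff matrix_vector_mul_assoc)
  show "transport \<phi> (mat 1) = id"
    by (simp add: transport_def fun_eq_iff)
  show "transport \<phi> M (v + w) = transport \<phi> M v + transport \<phi> M w"
    by (simp add: char \<phi>.add \<phi>_transport matrix_vector_right_distrib)
  show "transport \<phi> M (scaleQ q v) = scaleQ q (transport \<phi> M v)"
    by (simp add: char \<phi>.scale \<phi>_transport scaleQ_vec_def vector_scalar_commute)
qed

lemma generated_algebra_assoc_algebra:
  fixes S :: "('v::rat_vector \<Rightarrow> 'v) set"
  assumes add: "\<And>f v w. f \<in> generated_algebra S \<Longrightarrow> f (v + w) = f v + f w"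
    and scale: "\<And>f q v. f \<in> generated_algebra S \<Longrightarrow> f (scaleQ q v) = scaleQ q (f v)"
  shows "assoc_algebra scaleQ (\<circ>) id (generated_algebra S)"
proof unfold_locales
  have "(0 :: 'v \<Rightarrow> 'v) \<in> generated_algebra S"
    using generated_algebra.scale[OF generated_algebra.one, of 0 S] by simp
  then show "rat_vector.subspace (generated_algebra S)"
    by (auto simp: rat_vector.subspace_def intro: generated_algebra.add generated_algebra.scale)
qed (auto simp: fun_eq_iff scaleQ_fun_def add scale intro: generated_algebra.intros)

theorem proposition4p3:
  fixes H :: "'g::rat_lie_algebra set"
    and \<iota> :: "'f::field_char_0 \<Rightarrow> complex"
    and \<Phi> :: "('f, 'g) tensor \<Rightarrow> 'f^3^3"
    and B :: "('f^3) set"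
    and j :: "'w::rat_vector \<Rightarrow> 'f^3"
    and \<phi> :: "('f, 'w) tensor \<Rightarrow> 'f^3"
    and \<rho> :: "'g \<Rightarrow> ('f, 'w) tensor \<Rightarrow> ('f, 'w) tensor"
    and A :: "(('f, 'w) tensor \<Rightarrow> ('f, 'w) tensor) set"
  assumes simple: "simple_lie_algebra TYPE('g)"
    and dim_g: "rat_vector.dim (UNIV :: 'g set) = 8"
    and complexification:
      "\<exists>\<Psi> :: (complex, 'g) tensor \<Rightarrow> complex^3^3. lie_iso_sl scaleK bracketK \<Psi>"
    and cartan: "cartan_subalgebra H"
    and not_split: "\<not> split_cartan H"
    and number_field: "number_field TYPE('f)"
    and embedding: "field_embedding \<iota>"
    and eigenvalues: "\<And>h. h \<in> H \<Longrightarrow> ad_eigenvalues h \<subseteq> range \<iota>"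
    and \<Phi>: "lie_iso_sl scaleK bracketK \<Phi>"
    and basis: "vec.independent B" "vec.span B = UNIV"
    and j: "Vector_Spaces.linear scaleQ scaleQ_vec j" "inj j"
      "range j = module.span scaleQ_vec B"
    and \<phi>: "Vector_Spaces.linear scaleQ scaleQ_vec \<phi>" "bij \<phi>"
      "\<And>a w. \<phi> (pure_tensor a w) = a *s j w"
    and \<rho>: "\<rho> = rational_rep \<Phi> \<phi>"
    and A: "A = generated_algebra (range \<rho>)"
    and dim_A: "rat_vector.dim A = 9"
  shows "central_simple_algebra scaleQ (\<circ>) id A \<and>
    ((\<exists>f :: 'g \<Rightarrow> rat^3^3. lie_iso_sl scaleQ bracket f) \<longleftrightarrow>
     (\<exists>f :: (('f, 'w) tensor \<Rightarrow> ('f, 'w) tensor) \<Rightarrow> rat^3^3.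
        algebra_iso_matrix scaleQ (\<circ>) id A f))"
proof -
  define \<theta> where "\<theta> x = \<Phi> (pure_tensor 1 x)" for x
  define \<kappa> where "\<kappa> = transport \<phi>"
  interpret \<kappa>: Vector_Spaces.linear mscaleQ scaleQ \<kappa>
    unfolding \<kappa>_def by (rule transport_linear[OF \<phi>(1,2)])
  have \<kappa>_inj: "inj \<kappa>" and \<kappa>_mult: "\<And>M N. \<kappa> (M ** N) = \<kappa> M \<circ> \<kappa> N" and \<kappa>_one: "\<kappa> (mat 1) = id"
    and \<kappa>_apply: "\<And>M v w. \<kappa> M (v + w) = \<kappa> M v + \<kappa> M w" "\<And>M q v. \<kappa> M (scaleQ q v) = scaleQ q (\<kappa> M v)"
    unfolding \<kappa>_def
    by (rule transport_inj[OF \<phi>(1,2)] transport_mult[OF \<phi>(1,2)] transport_one[OF \<phi>(1,2)]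
        transport_apply_add[OF \<phi>(1,2)] transport_apply_scale[OF \<phi>(1,2)])+
  have \<rho>_eq: "\<rho> x = \<kappa> (\<theta> x)" for x
    by (simp add: \<rho> rational_rep_def \<kappa>_def transport_def \<theta>_def)
  interpret \<Phi>: Vector_Spaces.linear scaleK mscale \<Phi>
    using \<Phi> unfolding lie_iso_sl_def by blast
  have \<theta>_bracket: "\<theta> (bracket x y) = \<theta> x ** \<theta> y - \<theta> y ** \<theta> x" for x y
    using \<Phi> by (simp add: \<theta>_def lie_iso_sl_def commutator_def bracketK_pure[of 1 x 1 y, simplified, symmetric])
  have \<theta>_trace: "trace (\<theta> x) = 0" for x
    using \<Phi> by (auto simp: \<theta>_def lie_iso_sl_def bij_betw_def sl_def)
  interpret \<theta>: Vector_Spaces.linear scaleQ mscaleQ \<theta>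
  proof unfold_locales
    fix x y :: 'g and q
    show "\<theta> (x + y) = \<theta> x + \<theta> y"
      by (simp add: \<theta>_def pure_tensor_add_right \<Phi>.add)
    have "pure_tensor 1 (scaleQ q x) = scaleK (of_rat q :: 'f) (pure_tensor 1 x)"
      using pure_tensor_balanced[of "1 :: 'f" q x] by (simp add: scaleK_pure)
    then show "\<theta> (scaleQ q x) = mscaleQ q (\<theta> x)"
      by (simp add: \<theta>_def \<Phi>.scale mscaleQ_def)
  qed
  have sl_span: "sl \<subseteq> mscale.span (range \<theta>)"
    unfolding \<theta>_def by (rule sl_span_pure_tensors[OF \<Phi>])
  obtain x0 y0 where trace_xy: "trace (\<theta> x0 ** \<theta> y0) \<noteq> 0"
    using trace_form_nonzero[OF sl_span, of 0 1] by auto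
  have \<theta>_inj: "inj \<theta>"
  proof -
    have "lie_ideal {x. \<theta> x = 0}"
      by (auto simp: lie_ideal_def \<theta>.subspace_kernel \<theta>_bracket)
    then have "{x. \<theta> x = 0} = {0} \<or> {x. \<theta> x = 0} = UNIV"
      by (rule simple_lie_algebra_ideal[OF simple])
    moreover have "x0 \<notin> {x. \<theta> x = 0}"
      using trace_xy by (auto simp: trace_0[unfolded mat_0])
    ultimately have "x = 0" if "\<theta> x = 0" for x
      using that by blast
    then show ?thesis
      by (intro injI) (metis \<theta>.diff right_minus_eq)
  qed
  have scalar_range: "q = 0" if "mscaleQ q (mat 1) = \<theta> x" for q x
  proof -
    have "of_rat q * 3 = (0::'f)"
      using \<theta>_trace[of x] unfolding that[symmetric] by (simp add: mscaleQ_def trace_mscale trace_I)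
    then show ?thesis by simp
  qed

  \<comment> \<open>The identity and the image of a basis of \<open>\<gg>\<close> are \<open>9\<close> independent elements of \<open>A\<close>, hence a
    basis.\<close>
  obtain X :: "'g set" where X: "rat_vector.independent X" "UNIV \<subseteq> rat_vector.span X" "card X = 8"
    using rat_vector.basis_exists[of "UNIV :: 'g set"] dim_g by metis
  have finX: "finite X"
    using X(3) card.infinite by fastforce
  have span_\<theta>X: "mscaleQ.span (\<theta> ` X) = range \<theta>"
    using X(2) by (simp add: \<theta>.span_image top.extremum_unique)
  define C where "C = insert (mat 1) (\<theta> ` X)"
  have one_nin: "mat 1 \<notin> range \<theta>"
    using scalar_range[of 1] by auto
  have C_indQ: "mscaleQ.independent C"
    unfolding C_def
    by (rule mscaleQ.independent_insertI) (simp_all add: span_\<theta>X one_nin \<theta>.independent_inj_image[OF X(1) \<theta>_inj])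
  have finC: "finite C" and cardC: "card C = 9"
    using finX X(3) one_nin card_image[OF inj_on_subset[OF \<theta>_inj subset_UNIV], of X]
    by (auto simp: C_def card_insert_if)
  have "M \<in> mscaleQ.span C \<longleftrightarrow> (\<exists>q x. M = mscaleQ q (mat 1) + \<theta> x)" for M
    unfolding C_def mscaleQ.span_breakdown_eq span_\<theta>X by (auto simp: image_iff algebra_simps)
  then have span_C: "mscaleQ.span C = {mscaleQ q (mat 1) + \<theta> x | q x. True}"
    by auto

  have A_sub: "f \<in> range \<kappa>" if "f \<in> A" for f
    using that unfolding A
  proof induction
    case (generator f)
    then show ?case by (auto simp: \<rho>_eq)
  next
    case one
    show ?case by (simp flip: \<kappa>_one)
  next
    case (add f g)
    then obtain M N where "f = \<kappa> M" "g = \<kappa> N" by blast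
    then have "f + g = \<kappa> (M + N)" by (simp add: \<kappa>.add)
    then show ?case by (simp only: rangeI)
  next
    case (scale f q)
    then obtain M where "f = \<kappa> M" by blast
    then have "scaleQ q f = \<kappa> (mscaleQ q M)" by (simp add: \<kappa>.scale)
    then show ?case by (simp only: rangeI)
  next
    case (mult f g)
    then obtain M N where "f = \<kappa> M" "g = \<kappa> N" by blast
    then have "f \<circ> g = \<kappa> (M ** N)" by (simp add: \<kappa>_mult)
    then show ?case by (simp only: rangeI)
  qed
  interpret A: assoc_algebra scaleQ "(\<circ>)" id A
    unfolding A
    by (rule generated_algebra_assoc_algebra) (use A_sub \<kappa>_apply in \<open>force simp: A\<close>)+
  have A_eq: "A = \<kappa> ` mscaleQ.span C"
  proof -
    have indep: "rat_vector.independent (\<kappa> ` C)"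
      by (rule \<kappa>.independent_inj_image[OF C_indQ \<kappa>_inj])
    have card: "card (\<kappa> ` C) = 9"
      using card_image[OF inj_on_subset[OF \<kappa>_inj subset_UNIV], of C] cardC by simp
    have sub: "\<kappa> ` C \<subseteq> A"
      by (auto simp: C_def \<kappa>_one \<rho>_eq[symmetric] A intro: generated_algebra.intros)
    obtain Y where Y: "Y \<subseteq> A" "A \<subseteq> rat_vector.span Y" "card Y = 9"
      using rat_vector.basis_exists[of A] dim_A by metis
    have "finite Y"
      using Y(3) card.infinite by fastforce
    then have "A \<subseteq> rat_vector.span (\<kappa> ` C)"
      using Y card by (intro rat_vector.spans_if_independent_card[OF _ Y(2) sub indep]) simp_all
    then have "rat_vector.span (\<kappa> ` C) = A"
      by (rule rat_vector.span_subspace[OF sub _ A.carrier_subspace])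
    then show ?thesis
      by (simp add: \<kappa>.span_image)
  qed
  have A_iff: "\<kappa> M \<in> A \<longleftrightarrow> M \<in> mscaleQ.span C" for M
    using \<kappa>_inj by (auto simp: A_eq inj_def)
  have \<kappa>_scalar: "\<kappa> (mscaleQ q (mat 1) + \<theta> x) = scaleQ q id + \<rho> x" for q x
    by (simp add: \<kappa>.add \<kappa>.scale \<kappa>_one \<rho>_eq)
  interpret L: lie_scalar_algebra scaleQ "(\<circ>)" id A \<rho>
  proof unfold_locales
    show "simple_lie_algebra TYPE('g)"
      by (rule simple)
    show "\<rho> (x + y) = \<rho> x + \<rho> y" "\<rho> (scaleQ q x) = scaleQ q (\<rho> x)" for x y q
      by (simp_all add: \<rho>_eq \<theta>.add \<kappa>.add \<theta>.scale \<kappa>.scale)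
    show "\<rho> (bracket x y) = (\<rho> x \<circ> \<rho> y) - (\<rho> y \<circ> \<rho> x)" for x y
      unfolding \<rho>_eq \<theta>_bracket \<kappa>.diff \<kappa>_mult ..
    show "A = {scaleQ q id + \<rho> x | q x. True}"
      unfolding \<kappa>_scalar[symmetric] A_eq span_C by blast
    show "q = 0" if "scaleQ q id = \<rho> x" for q x
    proof (rule scalar_range)
      have "\<kappa> (mscaleQ q (mat 1)) = \<kappa> (\<theta> x)"
        using that by (simp add: \<kappa>.scale \<kappa>_one \<rho>_eq)
      then show "mscaleQ q (mat 1) = \<theta> x"
        by (rule injD[OF \<kappa>_inj])
    qed
    show "\<exists>x y. \<rho> x \<circ> \<rho> y \<notin> range \<rho>"
    proof (intro exI notI)
      assume "\<rho> x0 \<circ> \<rho> y0 \<in> range \<rho>"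
      then obtain z where "\<kappa> (\<theta> x0 ** \<theta> y0) = \<kappa> (\<theta> z)"
        by (auto simp: \<rho>_eq \<kappa>_mult)
      then have "\<theta> x0 ** \<theta> y0 = \<theta> z"
        by (rule injD[OF \<kappa>_inj])
      then show False
        using trace_xy \<theta>_trace by simp
    qed
    show "\<exists>X :: 'g set. finite X \<and> rat_vector.span X = UNIV"
      using finX X(2) by blast
  qed

  have "\<exists>f :: (('f, 'w) tensor \<Rightarrow> ('f, 'w) tensor) \<Rightarrow> rat^3^3. algebra_iso_matrix scaleQ (\<circ>) id A f"
    if iso: "lie_iso_sl scaleQ bracket g" for g :: "'g \<Rightarrow> rat^3^3"
  proof -
    \<comment> \<open>The square-zero element comes from a matrix of rank one in the rational form.\<close>
    obtain n where n: "n \<in> A" "n \<noteq> 0" "n \<circ> n = 0"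
      by (rule L.square_zero_of_lie_iso[OF iso, of 0 1]) auto
    then obtain N where N: "N \<in> mscaleQ.span C" "n = \<kappa> N"
      using A_eq by blast
    have "N \<noteq> 0"
      using n N by auto
    moreover have "\<kappa> (N ** N) = \<kappa> 0"
      using n N by (simp add: \<kappa>_mult)
    then have "N ** N = 0"
      by (rule injD[OF \<kappa>_inj])
    ultimately obtain u w where uw: "N = outer u w" "u \<noteq> 0" "w \<noteq> 0"
      using square_zero_rank_one[of N] by auto
    \<comment> \<open>Nine matrices that span \<open>M\<^sub>3(F)\<close> over \<open>F\<close> are independent over \<open>F\<close>.\<close>
    have spanC: "mscale.span C = UNIV"
    proof -
      have "M \<in> mscale.span C" for M
      proof -
        have one: "mat 1 \<in> mscale.span C"
          by (simp add: C_def mscale.span_base)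
        have "range \<theta> \<subseteq> mscale.span C"
          using mscaleQ_span_subset[of "\<theta> ` X"] mscale.span_mono[of "\<theta> ` X" C] span_\<theta>X
          by (auto simp: C_def)
        then have "mscale.span (range \<theta>) \<subseteq> mscale.span C"
          by (intro mscale.span_minimal) auto
        moreover have "M - mscale (trace M / 3) (mat 1) \<in> sl"
          by (simp add: sl_def trace_sub trace_mscale trace_I)
        ultimately have "M - mscale (trace M / 3) (mat 1) \<in> mscale.span C"
          using sl_span by blast
        then have "M - mscale (trace M / 3) (mat 1) + mscale (trace M / 3) (mat 1) \<in> mscale.span C"
          using one by (intro mscale.span_add mscale.span_scale)
        then show ?thesis by simp
      qed
      then show ?thesis by blast
    qed
    obtain E :: "('f^3^3) set" where E: "card E = 9" "mscale.independent E"
      using elementary_matrix_basis[where 'n = 3 and 'k = 'f] by auto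
    have C_ind: "mscale.independent C"
      by (rule mscale.independent_if_spans_independent[OF E(2)]) (simp_all add: spanC finC cardC E(1))
    have mult: "M ** M' \<in> mscaleQ.span C" if "M \<in> mscaleQ.span C" "M' \<in> mscaleQ.span C" for M M'
      using that A.mult_closed[of "\<kappa> M" "\<kappa> M'"] by (simp add: A_iff flip: \<kappa>_mult)
    obtain P Q :: "'f^3^3" where PQ: "P ** Q = mat 1" "Q ** P = mat 1"
      "mscaleQ.span C = range (\<lambda>R. P ** map_mat of_rat R ** Q)"
      by (rule rational_form_conjugate[OF C_ind spanC mult N(1)[unfolded uw(1)] uw(2,3)])
    define \<gamma> where "\<gamma> R = \<kappa> (P ** map_mat of_rat R ** Q)" for R :: "rat^3^3"
    have conj_inv: "Q ** (P ** M ** Q) ** P = M" for M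
    proof -
      have "Q ** (P ** M ** Q) ** P = (Q ** P) ** M ** (Q ** P)"
        by (simp only: matrix_mul_assoc)
      then show ?thesis
        by (simp add: PQ)
    qed
    have range_\<gamma>: "range \<gamma> = A"
      unfolding A_eq PQ(3) \<gamma>_def by (simp add: image_image)
    have inj_\<gamma>: "inj \<gamma>"
    proof (rule injI)
      fix R R' assume "\<gamma> R = \<gamma> R'"
      then have "P ** map_mat of_rat R ** Q = P ** map_mat of_rat R' ** Q"
        unfolding \<gamma>_def by (rule injD[OF \<kappa>_inj])
      then have "Q ** (P ** map_mat of_rat R ** Q) ** P = Q ** (P ** map_mat of_rat R' ** Q) ** P"
        by simp
      then have "map_mat of_rat R = (map_mat of_rat R' :: 'f^3^3)"
        by (simp only: conj_inv)
      then show "R = R'" by (simp add: map_mat_def vec_eq_iff)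
    qed
    have "P ** map_mat of_rat (R ** R') ** Q = (P ** map_mat of_rat R ** Q) ** (P ** map_mat of_rat R' ** Q)"
      for R R' :: "rat^3^3"
    proof -
      have "(P ** map_mat of_rat R ** Q) ** (P ** map_mat of_rat R' ** Q)
          = P ** map_mat of_rat R ** (Q ** P) ** map_mat of_rat R' ** Q"
        by (simp only: matrix_mul_assoc)
      then show ?thesis
        by (simp add: PQ map_mat_of_rat matrix_mul_assoc)
    qed
    then have \<gamma>_mult: "\<gamma> (R ** R') = \<gamma> R \<circ> \<gamma> R'" for R R'
      by (simp add: \<gamma>_def flip: \<kappa>_mult)
    have \<gamma>_add: "\<gamma> (R + R') = \<gamma> R + \<gamma> R'" and \<gamma>_scale: "\<gamma> (mscale q R) = scaleQ q (\<gamma> R)" for q R R'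
      by (simp_all add: \<gamma>_def map_mat_of_rat matrix_add_ldistrib matrix_add_rdistrib \<kappa>.add mscaleQ_def
          mscale_mult_left mscale_mult_right flip: \<kappa>.scale)
    have \<gamma>_one: "\<gamma> (mat 1) = id"
      by (simp add: \<gamma>_def map_mat_of_rat PQ(1) \<kappa>_one)
    have inv [simp]: "inv \<gamma> (\<gamma> R) = R" for R
      by (rule inv_f_f[OF inj_\<gamma>])
    have "algebra_iso_matrix scaleQ (\<circ>) id A (inv \<gamma>)"
      unfolding algebra_iso_matrix_def
    proof (intro conjI ballI allI)
      show "bij_betw (inv \<gamma>) A UNIV"
        unfolding range_\<gamma>[symmetric] by (rule bij_betw_inv_into) (simp add: inj_\<gamma> bij_betw_def)
      show "inv \<gamma> id = mat 1"
        by (simp flip: \<gamma>_one)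
      fix x y assume "x \<in> A" "y \<in> A"
      then obtain R R' where R: "x = \<gamma> R" "y = \<gamma> R'"
        using range_\<gamma> by blast
      show "inv \<gamma> (x + y) = inv \<gamma> x + inv \<gamma> y" "inv \<gamma> (x \<circ> y) = inv \<gamma> x ** inv \<gamma> y"
        by (simp_all add: R flip: \<gamma>_add \<gamma>_mult)
    next
      fix q x assume "x \<in> A"
      then obtain R where "x = \<gamma> R"
        using range_\<gamma> by blast
      then show "inv \<gamma> (scaleQ q x) = mscale q (inv \<gamma> x)"
        by (simp flip: \<gamma>_scale)
    qed
    then show ?thesis by blast
  qed
  then show ?thesis
    using L.central_simple L.lie_iso_of_matrix_iso by blast
qed

end
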